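(* Consider the bilinear system \[ \dot x(t) = Ax(t) + Bu(t) + \sum_{k=1}^m N_k x(t) u_k(t),\qquad y(t) = Cx(t),\quad t\ge 0, \] with $A, N_k\in\mathbb R^{n\times n}$, $B\in\mathbb R^{n\times m}$, $C\in\mathbb R^{p\times n}$, $u\in L^2$, and assume \[ \sigma\Big(A\otimes I+I\otimes A+ \sum_{k=1}^m N_k \otimes N_k\Big)\subset \mathbb C_- . \] Assume the realization $(A,B,C,N_k)$ is balanced, i.e. $P=Q=\Sigma=\operatorname{diag}(\sigma_1,\ldots,\sigma_n)>0$, where $P$ and $Q$ solve \[ A P + P A^T + \sum_{k=1}^m N_k P N_k^T = - B B^T,\qquad A^T Q + Q A + \sum_{k=1}^m N_k^T Q N_k = - C^T C, \] and partition \[ A=\begin{pmatrix}A_{11}&A_{12}\\ A_{21}&A_{22}\end{pmatrix},\ B=\begin{pmatrix}B_1\\ B_2\end{pmatrix},\ C=\begin{pmatrix}C_1& C_2\end{pmatrix},\ N_k=\begin{pmatrix}N_{k,11}&N_{k,12}\\ N_{k,21}&N_{k,22}\end{pmatrix},\ \Sigma=\begin{pmatrix}\Sigma_1&\\ &\Sigma_2\end{pmatrix}, \] with $A_{11}\in\mathbb R^{r\times r}$, $\Sigma_1\in\mathbb R^{r\times r}$, $\Sigma_2=\operatorname{diag}(\sigma_{r+1},\ldots,\sigma_n)$. Let $\hat y$ be the output of the reduced bilinear system $\dot{\hat x}=\hat A\hat x+\hat B u+\sum_{k=1}^m \hat N_k\hat x u_k$, $\hat y=\hat C\hat x$ with the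 singular perturbation approximation matrices \[ \hat A=A_{11}- A_{12} A_{22}^{-1} A_{21},\quad \hat B=B_1,\quad \hat C=C_1-C_2 A_{22}^{-1} A_{21},\quad \hat N_k=N_{k,11}-N_{k,12} A_{22}^{-1} A_{21}, \] and assume moreover $0 \notin \sigma\big(\hat A\otimes I+I\otimes \hat A+ \sum_{k=1}^m \hat N_k \otimes \hat N_k\big)$. Then, with zero initial conditions for both the full and the reduced system, \[ \sup_{t\geq 0}\left\|y(t)-\hat y(t)\right\|_2 \leq \left(\operatorname{tr}(\Sigma_2 K_{SPA})\right)^{\frac{1}{2}} \exp\left\{0.5\left\|u^{0}\right\|_{L^2}^2\right\} \left\|u\right\|_{L^2}, \] where \begin{align*} K_{SPA} = {}& B_2 B_2^T-2(A_{22}P_{g,2}+A_{21} P_{g,1})(A_{22}^{-1} A_{21})^T\\ &+ 2\sum_{k=1}^m (N_{k,22} P_{g,2}+N_{k,21}P_{g,1})(N_{k,21}-N_{k,22}A_{22}^{-1} A_{21})^T \\ &- \sum_{k=1}^m (N_{k,21}-N_{k,22}A_{22}^{-1} A_{21}) \hat P (N_{k,21}-N_{k,22}A_{22}^{-1} A_{21})^T, \end{align*} $\hat P$ solves $\hat A \hat P + \hat P \hat A^T + \sum_{k=1}^m \hat N_k \hat P \hat N_k^T = - \hat B \hat B^T$, and $P_g=\begin{pmatrix}P_{g,1}\\ P_{g,2}\end{pmatrix}$ (with $P_{g,1}\in\mathbb R^{r\times r}$) solves $A P_g + P_g \hat A^T + \sum_{k=1}^m N_k P_g \hat N_k^T =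 - B \hat B^T$.
   Context: Here $\|u\|_{L^2}^2=\int_0^\infty u^T(s)u(s)\,ds$, and $u^0=(u^0_1,\ldots,u^0_m)^T$ is the vector of control components with nonzero $N_k$: $u^0_k\equiv 0$ if $N_k=0$ and $u^0_k=u_k$ otherwise. $\mathbb C_-$ denotes the open left half complex plane. *)

theory Defs
  imports "HOL-Analysis.Analysis"
begin

text \<open>Real matrices are HOL-Analysis matrices real^'c^'r (rows 'r, columns 'c).
  The full state index type is 'r + 's (first r coordinates, then the remaining n - r),
  the reduced state index type is 'r, inputs are indexed by 'm, outputs by 'p.\<close>

definition kron :: "real^'a^'a \<Rightarrow> real^'b^'b \<Rightarrow> real^('a \<times> 'b)^('a \<times> 'b)" where
  "kron X Y = (\<chi> i j. X $ fst i $ fst j * Y $ snd i $ snd j)"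

definition idm :: "real^'a^'a" where
  "idm = mat 1"

definition cmat :: "real^'a^'a \<Rightarrow> complex^'a^'a" where
  "cmat M = (\<chi> i j. complex_of_real (M $ i $ j))"

definition cspectrum :: "real^'a^'a \<Rightarrow> complex set" where
  "cspectrum M = {z. \<exists>v::complex^'a. v \<noteq> 0 \<and> cmat M *v v = z *s v}"

definition kron_op :: "real^'a^'a \<Rightarrow> ('m \<Rightarrow> real^'a^'a) \<Rightarrow> real^('a \<times> 'a)^('a \<times> 'a)" where
  "kron_op A N = kron A idm + kron idm A + (\<Sum>k\<in>UNIV. kron (N k) (N k))"

definition diagm :: "('a \<Rightarrow> real) \<Rightarrow> real^'a^'a" where
  "diagm d = (\<chi> i j. if i = j then d i else 0)"

definition blk11 :: "real^('r::finite + 's::finite)^('r::finite + 's::finite) \<Rightarrow> real^'r^'r" where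
  "blk11 M = (\<chi> i j. M $ Inl i $ Inl j)"
definition blk12 :: "real^('r::finite + 's::finite)^('r::finite + 's::finite) \<Rightarrow> real^'s^'r" where
  "blk12 M = (\<chi> i j. M $ Inl i $ Inr j)"
definition blk21 :: "real^('r::finite + 's::finite)^('r::finite + 's::finite) \<Rightarrow> real^'r^'s" where
  "blk21 M = (\<chi> i j. M $ Inr i $ Inl j)"
definition blk22 :: "real^('r::finite + 's::finite)^('r::finite + 's::finite) \<Rightarrow> real^'s^'s" where
  "blk22 M = (\<chi> i j. M $ Inr i $ Inr j)"

definition rows1 :: "real^'c^('r::finite + 's::finite) \<Rightarrow> real^'c^'r" where
  "rows1 M = (\<chi> i j. M $ Inl i $ j)"
definition rows2 :: "real^'c^('r::finite + 's::finite) \<Rightarrow> real^'c^'s" where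
  "rows2 M = (\<chi> i j. M $ Inr i $ j)"
definition cols1 :: "real^('r::finite + 's::finite)^'q \<Rightarrow> real^'r^'q" where
  "cols1 M = (\<chi> i j. M $ i $ Inl j)"
definition cols2 :: "real^('r::finite + 's::finite)^'q \<Rightarrow> real^'s^'q" where
  "cols2 M = (\<chi> i j. M $ i $ Inr j)"

text \<open>State trajectory of the bilinear system
  x' = A x + B u + sum_k N_k x u_k, x(0) = 0, in the integral (Caratheodory) sense on [0,oo).\<close>
definition bilinear_traj ::
  "real^'n^'n \<Rightarrow> real^'m^'n \<Rightarrow> ('m \<Rightarrow> real^'n^'n) \<Rightarrow> (real \<Rightarrow> real^'m) \<Rightarrow> (real \<Rightarrow> real^'n) \<Rightarrow> bool" where
  "bilinear_traj A B N u x \<longleftrightarrow>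
     (\<forall>t\<ge>0. ((\<lambda>s. A *v x s + B *v u s + (\<Sum>k\<in>UNIV. u s $ k *s (N k *v x s))) has_integral x t) {0..t})"

definition in_L2 :: "(real \<Rightarrow> real^'m) \<Rightarrow> bool" where
  "in_L2 u \<longleftrightarrow> u measurable_on {0..} \<and> (\<lambda>s. (norm (u s))^2) integrable_on {0..}"

definition L2norm :: "(real \<Rightarrow> real^'m) \<Rightarrow> real" where
  "L2norm u = sqrt (integral {0..} (\<lambda>s. (norm (u s))^2))"

definition u_zero :: "('m \<Rightarrow> real^'n^'n) \<Rightarrow> (real \<Rightarrow> real^'m) \<Rightarrow> real \<Rightarrow> real^'m" where
  "u_zero N u = (\<lambda>s. \<chi> k. if N k = 0 then 0 else u s $ k)"


definition spaA :: "real^('r::finite + 's::finite)^('r + 's) \<Rightarrow> real^'r^'r" where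
  "spaA A = blk11 A - blk12 A ** matrix_inv (blk22 A) ** blk21 A"
definition spaB :: "real^'m^('r::finite + 's::finite) \<Rightarrow> real^'m^'r" where
  "spaB B = rows1 B"
definition spaC :: "real^('r::finite + 's::finite)^'p \<Rightarrow> real^('r + 's)^('r + 's) \<Rightarrow> real^'r^'p" where
  "spaC C A = cols1 C - cols2 C ** matrix_inv (blk22 A) ** blk21 A"
definition spaN :: "('m \<Rightarrow> real^('r::finite + 's::finite)^('r + 's)) \<Rightarrow> real^('r + 's)^('r + 's) \<Rightarrow> 'm \<Rightarrow> real^'r^'r" where
  "spaN N A = (\<lambda>k. blk11 (N k) - blk12 (N k) ** matrix_inv (blk22 A) ** blk21 A)"

definition spaM :: "('m \<Rightarrow> real^('r::finite + 's::finite)^('r + 's)) \<Rightarrow> real^('r + 's)^('r + 's) \<Rightarrow> 'm \<Rightarrow> real^'r^'s" where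
  "spaM N A = (\<lambda>k. blk21 (N k) - blk22 (N k) ** matrix_inv (blk22 A) ** blk21 A)"

definition K_SPA :: "real^('r::finite + 's::finite)^('r + 's) \<Rightarrow> real^('m::finite)^('r + 's)
     \<Rightarrow> ('m \<Rightarrow> real^('r + 's)^('r + 's)) \<Rightarrow> real^'r^'r \<Rightarrow> real^'r^('r + 's) \<Rightarrow> real^'s^'s" where
  "K_SPA A B N Phat Pg =
     rows2 B ** transpose (rows2 B)
     - 2 *\<^sub>R ((blk22 A ** rows2 Pg + blk21 A ** rows1 Pg) ** transpose (matrix_inv (blk22 A) ** blk21 A))
     + 2 *\<^sub>R (\<Sum>k\<in>UNIV. (blk22 (N k) ** rows2 Pg + blk21 (N k) ** rows1 Pg) ** transpose (spaM N A k))
     - (\<Sum>k\<in>UNIV. spaM N A k ** Phat ** transpose (spaM N A k))"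

end

theory Submission
  imports Defs
begin

text \<open>
  Stack the full and the reduced system. The matrix \<open>G\<close> with blocks \<open>\<Sigma>\<close>, \<open>P\<^sub>g\<close>, \<open>P\<^sub>g\<^sup>T\<close> and the
  reduced Gramian is the Gramian of the stacked system. If \<open>G\<close> is positive definite, completing squares shows that \<open>V(x) = x \<bullet> G\<^sup>-\<^sup>1 x\<close> satisfies
  \<open>V' \<le> |u|\<^sup>2 + |u\<^sup>0|\<^sup>2 V\<close> along trajectories, so Gronwall's inequality and Cauchy-Schwarz bound the
  error output by the trace of \<open>G\<close> compressed by the error output matrix, which a duality computation
  turns into \<open>tr (\<Sigma>\<^sub>2 K)\<close>. In general \<open>G\<close> is only semidefinite and is perturbed by a strict
  solution \<open>Y > 0\<close> of the Lyapunov inequality, whose size is sent to zero. For the full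
  system \<open>\<Sigma>\<close> plus a small multiple of the solution with right-hand side \<open>-I\<close> is such a \<open>Y\<close>.
  For the reduced system, compressing the observability equation shows that \<open>\<Sigma>\<^sub>1\<close> solves the
  dual inequality, and positivity is carried over by duality.
\<close>


section \<open>Positivity of Lyapunov forms\<close>

text \<open>For symmetric \<open>P\<close> this is the quadratic form of
  \<open>A^T P + P A + sum N_k^T P N_k\<close>. It takes maps instead of matrices so that the same
  facts serve a single system and the stacked system on a product space.\<close>

definition lyap_form :: "('a::real_inner \<Rightarrow> 'a) \<Rightarrow> ('m::finite \<Rightarrow> 'a \<Rightarrow> 'a) \<Rightarrow> ('a \<Rightarrow> 'a) \<Rightarrow> 'a \<Rightarrow> real" where
  "lyap_form A N P w = 2 * (A w \<bullet> P w) + (\<Sum>k\<in>UNIV. N k w \<bullet> P (N k w))"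

lemma lyap_form_add_scaleR:
  "lyap_form A N (\<lambda>w. P w + c *\<^sub>R Q w) w = lyap_form A N P w + c * lyap_form A N Q w"
  by (simp add: lyap_form_def inner_add_right sum.distrib sum_distrib_left algebra_simps)

text \<open>The form is nonnegative on every combination of \<open>v\<close> and \<open>w\<close>,
  which is a discriminant condition. \<open>P\<close> may be singular, so
  \<open>w \<bullet> P w = 0\<close> is a separate case.\<close>

lemma psd_cauchy_schwarz:
  fixes P :: "'a::real_inner \<Rightarrow> 'a"
  assumes "linear P" and sym: "\<And>v w. v \<bullet> P w = P v \<bullet> w" and psd: "\<And>w. 0 \<le> w \<bullet> P w"
  shows "(v \<bullet> P w)\<^sup>2 \<le> (v \<bullet> P v) * (w \<bullet> P w)"
proof -
  interpret linear P by fact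
  have wv: "w \<bullet> P v = v \<bullet> P w" using sym[of v w] by (simp add: inner_commute)
  have expand: "(s *\<^sub>R v + t *\<^sub>R w) \<bullet> P (s *\<^sub>R v + t *\<^sub>R w)
      = s\<^sup>2 * (v \<bullet> P v) + 2 * s * t * (v \<bullet> P w) + t\<^sup>2 * (w \<bullet> P w)" for s t
    by (simp add: add scale inner_add_left inner_add_right wv power2_eq_square algebra_simps)
  have quad: "0 \<le> s\<^sup>2 * (v \<bullet> P v) + 2 * s * t * (v \<bullet> P w) + t\<^sup>2 * (w \<bullet> P w)" for s t
    using psd[of "s *\<^sub>R v + t *\<^sub>R w"] expand by simp
  show ?thesis
  proof (cases "w \<bullet> P w = 0")
    case False
    then have pos: "w \<bullet> P w > 0" using psd[of w] by linarith
    have "0 \<le> (w \<bullet> P w) * ((v \<bullet> P v) * (w \<bullet> P w) - (v \<bullet> P w)\<^sup>2)"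
      using quad[of "w \<bullet> P w" "- (v \<bullet> P w)"] by (simp add: power2_eq_square algebra_simps)
    then show ?thesis using pos by (simp add: zero_le_mult_iff)
  next
    case True
    have "v \<bullet> P w = 0"
    proof (rule ccontr)
      \<comment> \<open>With \<open>w \<bullet> P w = 0\<close> the form is affine in the
        coefficient of \<open>w\<close>; the chosen coefficient gives it the value -1.\<close>
      assume ne: "v \<bullet> P w \<noteq> 0"
      show False
        using quad[of 1 "- (v \<bullet> P v + 1) / (2 * (v \<bullet> P w))"] True ne by (simp add: field_simps)
    qed
    then show ?thesis using True by simp
  qed
qed

lemma psd_null_vector:
  fixes P :: "'a::real_inner \<Rightarrow> 'a"
  assumes "linear P" and "\<And>v w. v \<bullet> P w = P v \<bullet> w" and "\<And>w. 0 \<le> w \<bullet> P w" and "w \<bullet> P w = 0"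
  shows "P w = 0"
  using psd_cauchy_schwarz[OF assms(1-3), of "P w" w] assms(4) by simp

lemma linear_form_continuous_on:
  fixes P :: "'a::euclidean_space \<Rightarrow> 'a"
  assumes "linear P"
  shows "continuous_on S (\<lambda>w. w \<bullet> P w)"
  using assms by (intro continuous_intros linear_continuous_on) (simp add: linear_conv_bounded_linear)

text \<open>The quotient of the two forms attains its minimum on the compact unit sphere, and
  homogeneity of degree two carries the bound to all vectors.\<close>

lemma sphere_min_ratio:
  fixes P Y :: "'a::euclidean_space \<Rightarrow> 'a"
  assumes P: "linear P" and Y: "linear Y" and Y_pos: "\<And>w. w \<noteq> 0 \<Longrightarrow> 0 < w \<bullet> Y w"
  obtains c w where "w \<noteq> 0" "w \<bullet> P w = c * (w \<bullet> Y w)" "\<And>v. c * (v \<bullet> Y v) \<le> v \<bullet> P v"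
proof -
  let ?S = "sphere (0::'a) 1" and ?r = "\<lambda>w. (w \<bullet> P w) / (w \<bullet> Y w)"
  have ne0: "w \<noteq> 0" if "w \<in> ?S" for w using that by auto
  have "continuous_on ?S ?r"
    using Y_pos ne0 by (intro continuous_intros linear_form_continuous_on P Y) fastforce
  moreover have "?S \<noteq> {}" by (metis vector_choose_size zero_le_one mem_sphere_0 empty_iff)
  ultimately have "\<exists>w\<in>?S. \<forall>v\<in>?S. ?r w \<le> ?r v"
    by (intro continuous_attains_inf compact_sphere)
  then obtain w where w: "w \<in> ?S" "\<And>v. v \<in> ?S \<Longrightarrow> ?r w \<le> ?r v" by blast
  have "?r w * (v \<bullet> Y v) \<le> v \<bullet> P v" for v
  proof (cases "v = 0")
    case False
    define n where "n = norm v"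
    define e where "e = v /\<^sub>R n"
    have n: "n > 0" and v: "v = n *\<^sub>R e" and e: "e \<in> ?S" using False by (auto simp: n_def e_def)
    have "?r w * (e \<bullet> Y e) \<le> e \<bullet> P e"
      using w(2)[OF e] Y_pos[OF ne0[OF e]] by (simp add: pos_le_divide_eq)
    then have "n\<^sup>2 * (?r w * (e \<bullet> Y e)) \<le> n\<^sup>2 * (e \<bullet> P e)" by (intro mult_left_mono) auto
    moreover have "v \<bullet> Y v = n\<^sup>2 * (e \<bullet> Y e)" "v \<bullet> P v = n\<^sup>2 * (e \<bullet> P e)"
      unfolding v by (simp_all add: linear_cmul[OF P] linear_cmul[OF Y] power2_eq_square)
    ultimately show ?thesis by (metis mult.left_commute)
  qed (simp add: linear_0[OF P])
  moreover have "w \<bullet> P w = ?r w * (w \<bullet> Y w)" using Y_pos[OF ne0[OF w(1)]] by simp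
  ultimately show thesis using that ne0[OF w(1)] by blast
qed

text \<open>At a minimiser of the quotient of the forms of \<open>P\<close> and \<open>Y\<close> the operator \<open>P - c Y\<close>
  is positive semidefinite with a null vector, where its Lyapunov form is nonnegative;
  this rules out a negative minimum.\<close>
lemma lyap_form_psd:
  fixes P Y :: "'a::euclidean_space \<Rightarrow> 'a"
  assumes P: "linear P" "\<And>v w. v \<bullet> P w = P v \<bullet> w"
    and Y: "linear Y" "\<And>v w. v \<bullet> Y w = Y v \<bullet> w" and Y_pos: "\<And>w. w \<noteq> 0 \<Longrightarrow> 0 < w \<bullet> Y w"
    and Y_neg: "\<And>w. w \<noteq> 0 \<Longrightarrow> lyap_form A N Y w < 0"
    and P_le: "\<And>w. lyap_form A N P w \<le> 0"
  shows "0 \<le> w \<bullet> P w"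
proof -
  obtain c v where v: "v \<noteq> 0" "v \<bullet> P v = c * (v \<bullet> Y v)" "\<And>v. c * (v \<bullet> Y v) \<le> v \<bullet> P v"
    using sphere_min_ratio[OF P(1) Y(1) Y_pos] by blast
  define D where "D = (\<lambda>w. P w + (- c) *\<^sub>R Y w)"
  have D: "linear D" unfolding D_def
    by (intro linear_compose_add linear_compose_scale_right P Y)
  have Dsym: "v \<bullet> D w = D v \<bullet> w" for v w
    by (simp add: D_def inner_add_left inner_add_right inner_diff_left inner_diff_right P(2) Y(2))
  have Dpsd: "0 \<le> w \<bullet> D w" for w using v(3)[of w] by (simp add: D_def inner_diff_right)
  have "v \<bullet> D v = 0" using v(2) by (simp add: D_def inner_diff_right)
  then have "D v = 0" using psd_null_vector[OF D Dsym Dpsd] by blast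
  then have "0 \<le> lyap_form A N D v" unfolding lyap_form_def using Dpsd by (simp add: sum_nonneg)
  then have "0 \<le> lyap_form A N P v - c * lyap_form A N Y v"
    unfolding D_def lyap_form_add_scaleR by simp
  then have "c * lyap_form A N Y v \<le> 0" using P_le[of v] by linarith
  then have "0 \<le> c" using Y_neg[OF v(1)] by (smt (verit) mult_neg_neg)
  then have "0 \<le> c * (w \<bullet> Y w)" using Y_pos[of w] by (cases "w = 0") (auto intro: less_imp_le)
  then show ?thesis using v(3)[of w] by linarith
qed

text \<open>\<open>Z\<close> may be indefinite, but its form is at least \<open>c\<close> times that
  of \<open>S\<close>. The choice \<open>e = 1 / (1 + \<bar>c\<bar>)\<close> keeps
  \<open>1 + e * c\<close> positive even for negative \<open>c\<close>.\<close>

lemma posdef_perturb: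
  fixes S Z :: "'a::euclidean_space \<Rightarrow> 'a"
  assumes "linear S" "linear Z" and S_pos: "\<And>w. w \<noteq> 0 \<Longrightarrow> 0 < w \<bullet> S w"
  obtains e where "0 < e" "\<And>w. w \<noteq> 0 \<Longrightarrow> 0 < w \<bullet> (S w + e *\<^sub>R Z w)"
proof -
  obtain c where c: "\<And>v. c * (v \<bullet> S v) \<le> v \<bullet> Z v"
    using sphere_min_ratio[OF assms(2,1) S_pos] by blast
  define e where "e = 1 / (1 + \<bar>c\<bar>)"
  have e: "0 < e" by (simp add: e_def add_pos_nonneg)
  have ec: "1 + e * c > 0" by (simp add: e_def field_simps add_pos_nonneg)
  have "0 < w \<bullet> (S w + e *\<^sub>R Z w)" if "w \<noteq> 0" for w
  proof -
    have "0 < (1 + e * c) * (w \<bullet> S w)" using ec S_pos[OF that] by simp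
    also have "\<dots> \<le> w \<bullet> (S w + e *\<^sub>R Z w)"
      using mult_left_mono[OF c[of w] less_imp_le[OF e]] by (simp add: inner_add_right algebra_simps)
    finally show ?thesis .
  qed
  then show thesis using that e by blast
qed


section \<open>The generalized Lyapunov operator on matrices\<close>

text \<open>The matrix \<open>kron_op A N\<close> represents this operator once a matrix is read as
  a vector indexed by pairs.\<close>

definition lyap_op :: "real^'n^'n \<Rightarrow> ('m::finite \<Rightarrow> real^'n^'n) \<Rightarrow> real^'n^'n \<Rightarrow> real^'n^'n" where
  "lyap_op A N X = A ** X + X ** transpose A + (\<Sum>k\<in>UNIV. N k ** X ** transpose (N k))"

section \<open>Transposes, linearity and the Frobenius inner product\<close>

lemma transpose_add: "transpose (X + Y) = transpose X + transpose Y"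
  by (simp add: transpose_def vec_eq_iff)

lemma transpose_scaleR: "transpose (c *\<^sub>R X) = c *\<^sub>R transpose (X :: real^'c^'d)"
  by (simp add: transpose_def vec_eq_iff)

lemma transpose_uminus: "transpose (- X) = - transpose (X :: real^'c^'d)"
  by (simp add: transpose_def vec_eq_iff)

lemma transpose_sum: "transpose (\<Sum>k\<in>S. X k) = (\<Sum>k\<in>S. transpose (X k))"
  by (simp add: transpose_def vec_eq_iff)

lemma matrix_add_rdistrib: "(X + Y) ** Z = X ** Z + Y ** (Z :: real^'c^'d)"
  by (simp add: matrix_matrix_mult_def vec_eq_iff sum.distrib distrib_right)

lemma matrix_scaleR_right: "X ** (c *\<^sub>R Y) = c *\<^sub>R (X ** (Y :: real^'c^'d))"
  by (simp add: matrix_matrix_mult_def vec_eq_iff sum_distrib_left mult_ac)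

lemma matrix_scaleR_left: "(c *\<^sub>R X) ** Y = c *\<^sub>R ((X :: real^'d^'e) ** (Y :: real^'c^'d))"
  by (simp add: matrix_matrix_mult_def vec_eq_iff sum_distrib_left mult_ac)

lemma matrix_vector_uminus_left: "(- X) *v w = - ((X :: real^'c^'d) *v w)"
  by (simp add: matrix_vector_mult_def vec_eq_iff sum_negf)

lemma matrix_vector_uminus_right: "X *v (- w) = - ((X :: real^'c^'d) *v w)"
  by (simp add: matrix_vector_mult_def vec_eq_iff sum_negf)

lemma matrix_vector_scaleR_left: "(c *\<^sub>R X) *v w = c *\<^sub>R ((X :: real^'c^'d) *v w)"
  by (simp add: matrix_vector_mult_def vec_eq_iff sum_distrib_left mult_ac)

lemma matrix_vector_sum_left: "(\<Sum>k\<in>S. X k) *v w = (\<Sum>k\<in>S. (X k :: real^'c^'d) *v w)"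
  by (induction S rule: infinite_finite_induct) (auto simp: matrix_vector_mult_add_rdistrib)

lemma inner_matrix_vector: "w \<bullet> (M *v v) = (transpose M *v w) \<bullet> (v :: real^'c)"
  by (simp add: dot_lmul_matrix)

lemma inner_matrix_mult_left: "(M ** X) \<bullet> Y = X \<bullet> (transpose M ** (Y :: real^'c^'d))"
proof -
  have "(M ** X) \<bullet> Y = (\<Sum>i\<in>UNIV. \<Sum>j\<in>UNIV. \<Sum>k\<in>UNIV. M$i$k * X$k$j * Y$i$j)"
    by (simp add: inner_vec_def matrix_matrix_mult_def sum_distrib_right)
  also have "\<dots> = (\<Sum>i\<in>UNIV. \<Sum>k\<in>UNIV. \<Sum>j\<in>UNIV. M$i$k * X$k$j * Y$i$j)"
    by (intro sum.cong refl sum.swap)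
  also have "\<dots> = (\<Sum>k\<in>UNIV. \<Sum>i\<in>UNIV. \<Sum>j\<in>UNIV. M$i$k * X$k$j * Y$i$j)"
    by (rule sum.swap)
  also have "\<dots> = (\<Sum>k\<in>UNIV. \<Sum>j\<in>UNIV. \<Sum>i\<in>UNIV. M$i$k * X$k$j * Y$i$j)"
    by (intro sum.cong refl sum.swap)
  also have "\<dots> = X \<bullet> (transpose M ** Y)"
    by (simp add: inner_vec_def matrix_matrix_mult_def transpose_def sum_distrib_left mult_ac)
  finally show ?thesis .
qed

lemma inner_transpose: "transpose X \<bullet> transpose Y = X \<bullet> (Y :: real^'c^'d)"
  by (simp add: inner_vec_def transpose_def) (rule sum.swap)

lemma inner_matrix_mult_right: "(X ** M) \<bullet> Y = X \<bullet> ((Y :: real^'c^'d) ** transpose M)"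
  using inner_matrix_mult_left[of "transpose M" "transpose X" "transpose Y"]
  by (metis inner_transpose matrix_transpose_mul)

lemma lyap_op_add: "lyap_op A N (X + Y) = lyap_op A N X + lyap_op A N Y"
  by (simp add: lyap_op_def matrix_add_ldistrib matrix_add_rdistrib sum.distrib)

lemma lyap_op_scaleR: "lyap_op A N (c *\<^sub>R X) = c *\<^sub>R lyap_op A N X"
  by (simp add: lyap_op_def matrix_scaleR_left matrix_scaleR_right scaleR_add_right scaleR_sum_right)

lemma linear_lyap_op: "linear (lyap_op A N)"
  by (rule linearI) (simp_all add: lyap_op_add lyap_op_scaleR)

lemma transpose_lyap_op: "transpose (lyap_op A N X) = lyap_op A N (transpose X)"
  by (simp add: lyap_op_def transpose_add transpose_sum matrix_transpose_mul matrix_mul_assoc add_ac)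

text \<open>On matrices \<open>\<bullet>\<close> is the Frobenius product, across which each factor
  moves as its transpose. Hence the controllability and observability operators are adjoint, the
  duality used throughout.\<close>

lemma lyap_op_inner: "lyap_op A N X \<bullet> Y = X \<bullet> lyap_op (transpose A) (\<lambda>k. transpose (N k)) Y"
proof -
  have "(N k ** X ** transpose (N k)) \<bullet> Y = X \<bullet> (transpose (N k) ** Y ** N k)" for k
    using inner_matrix_mult_right[of "N k ** X" "transpose (N k)" Y]
      inner_matrix_mult_left[of "N k" X "Y ** N k"]
    by (simp add: matrix_mul_assoc)
  moreover have "(A ** X) \<bullet> Y = X \<bullet> (transpose A ** Y)" by (rule inner_matrix_mult_left)
  moreover have "(X ** transpose A) \<bullet> Y = X \<bullet> (Y ** A)"
    using inner_matrix_mult_right[of X "transpose A" Y] by simp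
  ultimately show ?thesis
    by (simp add: lyap_op_def inner_add_left inner_add_right inner_sum_left inner_sum_right)
qed

text \<open>Under vectorization the Kronecker product of \<open>M\<close> and \<open>L\<close> acts
  as \<open>M ** X ** transpose L\<close>. A nonzero kernel element would therefore be an
  eigenvector of \<open>kron_op A N\<close> for the eigenvalue 0, made complex to match
  \<open>cspectrum\<close>.\<close>

lemma lyap_op_injective:
  assumes "0 \<notin> cspectrum (kron_op A N)" and "lyap_op A N X = 0"
  shows "X = 0"
proof (rule ccontr)
  assume "X \<noteq> 0"
  define v where "v = (\<chi> i. complex_of_real (X $ fst i $ snd i))"
  have "v \<noteq> 0"
  proof
    assume "v = 0"
    then have "X $ i $ j = 0" for i j
    proof -
      have "v $ (i, j) = 0" using \<open>v = 0\<close> by simp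
      then show ?thesis by (simp add: v_def)
    qed
    then show False using \<open>X \<noteq> 0\<close> by (simp add: vec_eq_iff)
  qed
  have k: "(\<Sum>q\<in>UNIV. kron M L $ p $ q * X $ fst q $ snd q) = (M ** X ** transpose L) $ fst p $ snd p"
    for M L :: "real^'a^'a" and p
  proof -
    have "(\<Sum>q\<in>UNIV. kron M L $ p $ q * X $ fst q $ snd q)
        = (\<Sum>j\<in>UNIV. \<Sum>l\<in>UNIV. M $ fst p $ j * L $ snd p $ l * X $ j $ l)"
      by (simp add: kron_def UNIV_Times_UNIV[symmetric] sum.cartesian_product case_prod_unfold
          del: UNIV_Times_UNIV)
    also have "\<dots> = (\<Sum>l\<in>UNIV. \<Sum>j\<in>UNIV. M $ fst p $ j * L $ snd p $ l * X $ j $ l)"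
      by (rule sum.swap)
    also have "\<dots> = (M ** X ** transpose L) $ fst p $ snd p"
      by (simp add: matrix_matrix_mult_def transpose_def sum_distrib_left mult_ac)
    finally show ?thesis .
  qed
  have "(\<Sum>q\<in>UNIV. kron_op A N $ p $ q * X $ fst q $ snd q) = lyap_op A N X $ fst p $ snd p" for p
  proof -
    have "(\<Sum>q\<in>UNIV. kron_op A N $ p $ q * X $ fst q $ snd q)
      = (\<Sum>q\<in>UNIV. kron A idm $ p $ q * X $ fst q $ snd q)
        + (\<Sum>q\<in>UNIV. kron idm A $ p $ q * X $ fst q $ snd q)
        + (\<Sum>q\<in>UNIV. \<Sum>k\<in>UNIV. kron (N k) (N k) $ p $ q * X $ fst q $ snd q)"
      by (simp add: kron_op_def distrib_right sum.distrib sum_distrib_right)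
    also have "(\<Sum>q\<in>UNIV. \<Sum>k\<in>UNIV. kron (N k) (N k) $ p $ q * X $ fst q $ snd q)
      = (\<Sum>k\<in>UNIV. \<Sum>q\<in>UNIV. kron (N k) (N k) $ p $ q * X $ fst q $ snd q)"
      by (rule sum.swap)
    finally show ?thesis by (simp add: k lyap_op_def idm_def transpose_mat)
  qed
  then have "(\<Sum>q\<in>UNIV. kron_op A N $ p $ q * X $ fst q $ snd q) = 0" for p
    using assms(2) by simp
  then have "cmat (kron_op A N) *v v = 0 *s v"
    by (simp add: vec_eq_iff matrix_vector_mult_def cmat_def v_def
        of_real_mult[symmetric] of_real_sum[symmetric] del: of_real_mult of_real_sum)
  then show False using assms(1) \<open>v \<noteq> 0\<close> unfolding cspectrum_def by blast
qed

text \<open>In finite dimension injectivity gives existence; since the operator commutes with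
  transposition, uniqueness makes the solution symmetric.\<close>

lemma lyap_op_solvable:
  assumes inj: "\<And>X. lyap_op A N X = 0 \<Longrightarrow> X = 0" and R: "transpose R = R"
  obtains X where "lyap_op A N X = R" "transpose X = X"
proof -
  have "inj (lyap_op A N)" using inj linear_injective_0[OF linear_lyap_op] by blast
  then have "surj (lyap_op A N)"
    by (rule linear_injective_imp_surjective[OF linear_lyap_op]) simp
  then obtain X where X: "lyap_op A N X = R" by (metis surjD)
  then have "lyap_op A N (transpose X) = lyap_op A N X" using R by (simp add: transpose_lyap_op[symmetric])
  then have "transpose X = X" using \<open>inj (lyap_op A N)\<close> by (simp add: inj_eq)
  then show thesis using that X by blast
qed

text \<open>A kernel element of the adjoint is orthogonal to the range, which is the whole space,
  hence to itself.\<close>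

lemma lyap_op_dual_injective:
  assumes inj: "\<And>X. lyap_op A N X = 0 \<Longrightarrow> X = 0"
    and "lyap_op (transpose A) (\<lambda>k. transpose (N k)) X = 0"
  shows "X = 0"
proof -
  have "inj (lyap_op A N)" using inj linear_injective_0[OF linear_lyap_op] by blast
  then have "surj (lyap_op A N)"
    by (rule linear_injective_imp_surjective[OF linear_lyap_op]) simp
  then obtain Y where "lyap_op A N Y = X" by (metis surjD)
  then have "X \<bullet> X = 0" using lyap_op_inner[of A N Y X] assms(2) by simp
  then show ?thesis by simp
qed

text \<open>Symmetry of \<open>P\<close> makes \<open>A ** P\<close> and
  \<open>P ** transpose A\<close> contribute equally, which is the factor 2 in
  \<open>lyap_form\<close>. The coefficients appear transposed.\<close>

lemma lyap_op_form:
  assumes "transpose P = P"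
  shows "w \<bullet> (lyap_op A N P *v w)
    = lyap_form ((*v) (transpose A)) (\<lambda>k. (*v) (transpose (N k))) ((*v) P) w"
proof -
  have "w \<bullet> (P ** transpose A *v w) = w \<bullet> (A ** P *v w)"
    using inner_matrix_vector[of w "P ** transpose A" w] assms
    by (simp add: matrix_transpose_mul inner_commute)
  moreover have "w \<bullet> (A ** P *v w) = (transpose A *v w) \<bullet> (P *v w)"
    by (simp add: matrix_vector_mul_assoc[symmetric] inner_matrix_vector)
  moreover have "w \<bullet> (N k ** P ** transpose (N k) *v w)
      = (transpose (N k) *v w) \<bullet> (P *v (transpose (N k) *v w))" for k
    by (simp only: matrix_vector_mul_assoc[symmetric] inner_matrix_vector)
  ultimately show ?thesis
    by (simp add: lyap_op_def lyap_form_def matrix_vector_mult_add_rdistrib matrix_vector_sum_left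
        inner_add_right inner_sum_right)
qed

text \<open>A multiple of the solution \<open>Z\<close> with right-hand side \<open>- mat 1\<close>
  makes the inequality for \<open>S\<close> strict. The sign of \<open>Z\<close> is unknown, so the
  multiple is taken small enough to keep \<open>S\<close> positive definite.\<close>

lemma lyap_op_strict_solution:
  fixes A :: "real^'n^'n"
  assumes inj: "\<And>X. lyap_op A N X = 0 \<Longrightarrow> X = 0"
    and S: "transpose S = S" "\<And>w. w \<noteq> 0 \<Longrightarrow> 0 < w \<bullet> (S *v w)"
    and S_le: "\<And>w. w \<bullet> (lyap_op A N S *v w) \<le> 0"
  obtains Y where "transpose Y = Y" "\<And>w. w \<noteq> 0 \<Longrightarrow> 0 < w \<bullet> (Y *v w)"
    "\<And>w. w \<noteq> 0 \<Longrightarrow> w \<bullet> (lyap_op A N Y *v w) < 0"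
proof -
  have "transpose (- mat 1 :: real^'n^'n) = - mat 1" by (simp add: transpose_uminus transpose_mat)
  then obtain Z where Z: "lyap_op A N Z = - mat 1" "transpose Z = Z"
    using lyap_op_solvable[OF inj] by blast
  obtain e where e: "0 < e" "\<And>w. w \<noteq> 0 \<Longrightarrow> 0 < w \<bullet> (S *v w + e *\<^sub>R (Z *v w))"
    using posdef_perturb[OF matrix_vector_mul_linear matrix_vector_mul_linear S(2)] by blast
  define Y where "Y = S + e *\<^sub>R Z"
  have "transpose Y = Y" by (simp add: Y_def transpose_add transpose_scaleR S Z)
  moreover have "0 < w \<bullet> (Y *v w)" if "w \<noteq> 0" for w
    using e(2)[OF that] by (simp add: Y_def matrix_vector_mult_add_rdistrib matrix_vector_scaleR_left)
  moreover have "w \<bullet> (lyap_op A N Y *v w) < 0" if "w \<noteq> 0" for w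
  proof -
    have "lyap_op A N Y *v w = lyap_op A N S *v w - e *\<^sub>R w"
      by (simp add: Y_def lyap_op_add lyap_op_scaleR Z matrix_vector_mult_add_rdistrib matrix_vector_mult_diff_rdistrib
          matrix_vector_scaleR_left matrix_vector_uminus_left)
    then show ?thesis using S_le[of w] e(1) that
      by (simp add: inner_diff_right) (smt (verit) inner_gt_zero_iff mult_pos_pos)
  qed
  ultimately show thesis using that by blast
qed

text \<open>By duality \<open>w \<bullet> (Z *v w)\<close> is the trace of \<open>W\<close>, where
  \<open>W\<close> solves the dual equation with right-hand side minus the rank-one matrix of
  \<open>w\<close>. The strict dual solution \<open>Y\<close> makes \<open>W\<close> positive
  semidefinite, and a vanishing trace would force \<open>W = 0\<close> and then
  \<open>w = 0\<close>.\<close>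

lemma lyap_op_positive_solution:
  fixes A :: "real^'n^'n"
  assumes inj: "\<And>X. lyap_op A N X = 0 \<Longrightarrow> X = 0"
    and Y: "transpose Y = Y" "\<And>w. w \<noteq> 0 \<Longrightarrow> 0 < w \<bullet> (Y *v w)"
    and Y_less: "\<And>w. w \<noteq> 0 \<Longrightarrow> w \<bullet> (lyap_op (transpose A) (\<lambda>k. transpose (N k)) Y *v w) < 0"
  obtains Z where "transpose Z = Z" "lyap_op A N Z = - mat 1" "\<And>w. w \<noteq> 0 \<Longrightarrow> 0 < w \<bullet> (Z *v w)"
proof -
  let ?L = "lyap_op (transpose A) (\<lambda>k. transpose (N k))"
  have "transpose (- mat 1 :: real^'n^'n) = - mat 1" by (simp add: transpose_uminus transpose_mat)
  then obtain Z where Z: "lyap_op A N Z = - mat 1" "transpose Z = Z"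
    using lyap_op_solvable[OF inj] by blast
  have dual_inj: "X = 0" if "?L X = 0" for X
    using lyap_op_dual_injective[OF inj] that by blast
  have symI: "v \<bullet> (M *v w) = (M *v v) \<bullet> w" if "transpose M = M" for M :: "real^'n^'n" and v w
    using inner_matrix_vector[of v M w] that by simp
  have "0 < w \<bullet> (Z *v w)" if "w \<noteq> 0" for w
  proof -
    define R :: "real^'n^'n" where "R = (\<chi> i j. w $ i * w $ j)"
    have "transpose (- R) = - R" by (simp add: R_def transpose_def vec_eq_iff mult.commute)
    then obtain W where W: "?L W = - R" "transpose W = W"
      using lyap_op_solvable[OF dual_inj] by blast
    have R_form: "v \<bullet> (R *v v) = (v \<bullet> w)\<^sup>2" for v
      by (simp add: R_def inner_vec_def matrix_vector_mult_def power2_eq_square sum_product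
          sum_distrib_left mult_ac)
    have psd: "0 \<le> v \<bullet> (W *v v)" for v
    proof (rule lyap_form_psd[where Y = "(*v) Y"])
      fix v
      have "lyap_form ((*v) (transpose (transpose A))) (\<lambda>k. (*v) (transpose (transpose (N k)))) ((*v) W) v
          = - (v \<bullet> w)\<^sup>2"
        using lyap_op_form[OF W(2), of v "transpose A" "\<lambda>k. transpose (N k)"] W(1) R_form[of v]
        by (simp add: matrix_vector_uminus_left)
      then show "lyap_form ((*v) (transpose (transpose A))) (\<lambda>k. (*v) (transpose (transpose (N k)))) ((*v) W) v \<le> 0"
        by (metis neg_le_0_iff_le zero_le_power2)
    next
      show "lyap_form ((*v) (transpose (transpose A))) (\<lambda>k. (*v) (transpose (transpose (N k)))) ((*v) Y) v < 0"
        if "v \<noteq> 0" for v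
        using lyap_op_form[OF Y(1), of v "transpose A" "\<lambda>k. transpose (N k)"] Y_less[OF that] by simp
    qed (use Y W symI in auto)
    have "w \<bullet> (Z *v w) = Z \<bullet> R"
      by (simp add: R_def inner_vec_def matrix_vector_mult_def sum_distrib_left mult_ac)
    also have "\<dots> = mat 1 \<bullet> W"
      using lyap_op_inner[of A N Z W] W(1) Z(1) by simp
    also have "\<dots> = (\<Sum>i\<in>UNIV. W $ i $ i)"
      by (simp add: inner_vec_def mat_def if_distrib[of "\<lambda>c. c * _"] cong: if_cong)
    finally have eq: "w \<bullet> (Z *v w) = (\<Sum>i\<in>UNIV. W $ i $ i)" .
    have diag: "W $ i $ i = axis i 1 \<bullet> (W *v axis i 1)" for i
      by (simp add: matrix_vector_mul_component inner_axis' inner_axis)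
    have nonneg: "0 \<le> W $ i $ i" for i using psd[of "axis i 1"] diag by simp
    have "(\<Sum>i\<in>UNIV. W $ i $ i) \<noteq> 0"
    proof
      assume "(\<Sum>i\<in>UNIV. W $ i $ i) = 0"
      then have "W $ i $ i = 0" for i using nonneg by (simp add: sum_nonneg_eq_0_iff)
      \<comment> \<open>A zero diagonal entry of a semidefinite matrix annihilates the whole
        column.\<close>
      then have "W *v axis i 1 = 0" for i
        using psd_null_vector[OF matrix_vector_mul_linear symI[OF W(2)] psd] diag by metis
      then have "W = 0" by (simp add: matrix_vector_mult_basis column_def vec_eq_iff)
      then have "R = 0" using W(1) linear_0[OF linear_lyap_op] by (metis neg_equal_0_iff_equal)
      then have "(w \<bullet> w)\<^sup>2 = 0" using R_form[of w] by simp
      then show False using that by simp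
    qed
    moreover have "0 \<le> (\<Sum>i\<in>UNIV. W $ i $ i)" using nonneg by (simp add: sum_nonneg)
    ultimately show ?thesis using eq by linarith
  qed
  then show thesis using that Z by blast
qed


section \<open>Gronwall estimate for absolutely continuous trajectories\<close>

text \<open>Increments over a partition finer than \<open>d\<close> telescope, so the total error is
  at most \<open>e * (\<mu> b - \<mu> a)\<close> with \<open>e\<close> arbitrary. No
  differentiability is involved.\<close>

lemma almost_decreasing_imp_le:
  fixes \<Phi> \<mu> :: "real \<Rightarrow> real"
  assumes "a \<le> b"
    and local: "\<And>e. 0 < e \<Longrightarrow> \<exists>d>0. \<forall>s t. a \<le> s \<and> s \<le> t \<and> t \<le> b \<and> t - s < d \<longrightarrow> \<Phi> t - \<Phi> s \<le> e * (\<mu> t - \<mu> s)"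
  shows "\<Phi> b \<le> \<Phi> a"
proof -
  have le: "\<Phi> b - \<Phi> a \<le> e * (\<mu> b - \<mu> a)" if e: "0 < e" for e
  proof -
    obtain d where d: "0 < d"
      "\<And>s t. a \<le> s \<Longrightarrow> s \<le> t \<Longrightarrow> t \<le> b \<Longrightarrow> t - s < d \<Longrightarrow> \<Phi> t - \<Phi> s \<le> e * (\<mu> t - \<mu> s)"
      using local[OF e] by blast
    obtain n :: nat where n: "(b - a) / d < real n" using reals_Archimedean2 by blast
    have n0: "0 < n" using n d(1) assms(1) by (cases n) (auto simp: field_simps)
    define h where "h = (b - a) / real n"
    have h: "0 \<le> h" "h < d" using n n0 d(1) assms(1) by (auto simp: h_def field_simps)
    have hn: "real n * h = b - a" using n0 by (simp add: h_def)
    have "\<Phi> (a + real k * h) - \<Phi> a \<le> e * (\<mu> (a + real k * h) - \<mu> a)" if "k \<le> n" for k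
      using that
    proof (induction k)
      case (Suc k)
      have "real (Suc k) * h \<le> real n * h" using Suc.prems h(1) by (intro mult_right_mono) auto
      then have "\<Phi> (a + real (Suc k) * h) - \<Phi> (a + real k * h)
          \<le> e * (\<mu> (a + real (Suc k) * h) - \<mu> (a + real k * h))"
        using h hn by (intro d(2)) (auto simp: algebra_simps)
      then show ?case using Suc by (simp add: algebra_simps)
    qed simp
    from this[of n] show ?thesis using hn by simp
  qed
  show ?thesis
  proof (rule ccontr)
    assume "\<not> \<Phi> b \<le> \<Phi> a"
    then have pos: "0 < \<Phi> b - \<Phi> a" by simp
    define c where "c = 1 + \<bar>\<mu> b - \<mu> a\<bar>"
    have c: "0 < c" "\<mu> b - \<mu> a \<le> c" by (auto simp: c_def)
    \<comment> \<open>This \<open>e\<close> makes the total error at most half of the supposed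
      positive gap; the 1 in \<open>c\<close> avoids division by zero.\<close>
    define e where "e = (\<Phi> b - \<Phi> a) / (2 * c)"
    have e: "0 < e" using pos c by (simp add: e_def)
    have "\<Phi> b - \<Phi> a \<le> e * c"
      using le[OF e] mult_left_mono[OF c(2), of e] e by linarith
    also have "\<dots> = (\<Phi> b - \<Phi> a) / 2" using c(1) by (simp add: e_def)
    finally show False using pos by simp
  qed
qed

lemma indefinite_integral_continuous_on:
  fixes x f :: "real \<Rightarrow> 'a::euclidean_space"
  assumes "\<And>t. 0 \<le> t \<Longrightarrow> t \<le> T \<Longrightarrow> (f has_integral x t) {0..t}"
  shows "continuous_on {0..T} x"
proof (cases "0 \<le> T")
  case True
  then have "f integrable_on {0..T}" using assms by blast
  then have "continuous_on {0..T} (\<lambda>t. integral {0..t} f)" by (rule indefinite_integral_continuous_1)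
  moreover have "integral {0..t} f = x t" if "t \<in> {0..T}" for t
    using assms that by (auto intro: integral_unique)
  ultimately show ?thesis by (rule continuous_on_eq)
qed simp

text \<open>The product \<open>(1 - g + g^2) * (1 + g)\<close> equals \<open>1 + g^3\<close>, and
  \<open>1 + g\<close> is at most \<open>exp g\<close>.\<close>

lemma exp_minus_le_quadratic:
  fixes g :: real
  assumes "0 \<le> g"
  shows "exp (- g) \<le> 1 - g + g\<^sup>2"
proof -
  have "1 \<le> (1 - g + g\<^sup>2) * (1 + g)" using assms by (simp add: power2_eq_square algebra_simps)
  also have "\<dots> \<le> (1 - g + g\<^sup>2) * exp g"
  proof (rule mult_left_mono)
    have "0 \<le> (1 - g)\<^sup>2 + g" using assms by simp
    then show "0 \<le> 1 - g + g\<^sup>2" by (simp add: power2_eq_square algebra_simps)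
  qed (rule exp_ge_add_one_self)
  finally show ?thesis by (simp add: exp_minus field_simps)
qed

text \<open>The input is merely square integrable, so the trajectory is only absolutely continuous.
  Instead of differentiating the quadratic form, its increments are written exactly as
  \<open>(x b - x a) \<bullet> R (x a + x b)\<close> and compared with the dissipation bound up to an error that is small
  relative to a fixed monotone function.\<close>
lemma gronwall_quadratic_form:
  fixes x f :: "real \<Rightarrow> 'a::euclidean_space" and R :: "'a \<Rightarrow> 'a" and g h m :: "real \<Rightarrow> real"
  assumes T: "0 \<le> T"
    and x: "\<And>t. 0 \<le> t \<Longrightarrow> t \<le> T \<Longrightarrow> (f has_integral x t) {0..t}"
    and R: "linear R" and R_sym: "\<And>v w. v \<bullet> R w = R v \<bullet> w" and R_psd: "\<And>v. 0 \<le> v \<bullet> R v"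
    and m: "m integrable_on {0..T}" "\<And>s. s \<in> {0..T} \<Longrightarrow> norm (f s) \<le> m s"
    and g: "g integrable_on {0..T}" "\<And>s. 0 \<le> g s"
    and h: "h integrable_on {0..T}" "\<And>s. 0 \<le> h s"
    and diss: "\<And>s. s \<in> {0..T} \<Longrightarrow> 2 * (f s \<bullet> R (x s)) \<le> h s + g s * (x s \<bullet> R (x s))"
  shows "x T \<bullet> R (x T) \<le> exp (integral {0..T} g) * integral {0..T} h"
proof -
  define V where "V = (\<lambda>s. x s \<bullet> R (x s))"
  define G where "G = (\<lambda>t. integral {0..t} g)"
  define H where "H = (\<lambda>t. integral {0..t} h)"
  define M where "M = (\<lambda>t. integral {0..t} m)"
  have cont_x: "continuous_on {0..T} x" using x by (rule indefinite_integral_continuous_on)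
  have "bounded_linear R" using R by (simp add: linear_conv_bounded_linear)
  then have "continuous_on {0..T} (\<lambda>s. R (x s))" using cont_x by (rule bounded_linear.continuous_on)
  with cont_x have cont_V: "continuous_on {0..T} V" unfolding V_def by (rule continuous_on_inner)
  have cont_G: "continuous_on {0..T} G" unfolding G_def by (rule indefinite_integral_continuous_1[OF g(1)])
  have V0: "0 \<le> V s" for s using R_psd by (simp add: V_def)
  obtain K where K: "0 < K" "\<And>v. norm (R v) \<le> K * norm v" using linear_bounded_pos[OF R] by blast
  obtain c where c: "0 < c" "\<And>s. s \<in> {0..T} \<Longrightarrow> V s \<le> c"
  proof -
    have "bounded (V ` {0..T})" using cont_V by (intro compact_imp_bounded compact_continuous_image) auto
    then obtain c where "0 < c" "\<forall>y\<in>V ` {0..T}. norm y \<le> c" by (auto simp: bounded_pos)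
    then show thesis by (intro that[of c]) (auto dest: bspec abs_le_D1)
  qed
  have incr: "integral {0..b} q - integral {0..a} q = integral {a..b} q" "q integrable_on {a..b}"
    if "q integrable_on {0..T}" "0 \<le> a" "a \<le> b" "b \<le> T" for q :: "real \<Rightarrow> 'b::banach" and a b
  proof -
    have "q integrable_on {0..b}" using that by (auto intro: integrable_on_subinterval)
    then show "integral {0..b} q - integral {0..a} q = integral {a..b} q"
      using Henstock_Kurzweil_Integration.integral_combine[of 0 a b q] that by (simp add: algebra_simps)
    show "q integrable_on {a..b}" using that by (auto intro: integrable_on_subinterval)
  qed
  \<comment> \<open>The error is measured by \<open>2 * G + M\<close>: one increment of
    \<open>G\<close> pays for replacing \<open>V s\<close> by \<open>V b\<close>, the other for the
    quadratic remainder of \<open>exp\<close>, and \<open>M\<close> for replacing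
    \<open>2 * x s\<close> by \<open>x a + x b\<close>.\<close>
  have "exp (- G T) * V T - H T \<le> exp (- G 0) * V 0 - H 0"
  proof (rule almost_decreasing_imp_le[where \<Phi> = "\<lambda>t. exp (- G t) * V t - H t" and \<mu> = "\<lambda>t. 2 * G t + M t"])
    fix e :: real assume e: "0 < e"
    have ux: "uniformly_continuous_on {0..T} x" and uV: "uniformly_continuous_on {0..T} V"
      and uG: "uniformly_continuous_on {0..T} G"
      using cont_x cont_V cont_G by (auto intro: compact_uniformly_continuous)
    \<comment> \<open>The tolerance \<open>e / (2 * K)\<close> at each endpoint gives
      \<open>norm (R z) \<le> e\<close> below; \<open>e / c\<close> makes the increment of
      \<open>G\<close> times \<open>V b\<close> at most \<open>e\<close>.\<close>
    have "0 < e / (2 * K)" "0 < e / c" using e K c by auto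
    then obtain d1 d2 d3 where d: "0 < d1" "0 < d2" "0 < d3"
      and d1: "\<forall>t\<in>{0..T}. \<forall>s\<in>{0..T}. dist s t < d1 \<longrightarrow> dist (x s) (x t) < e / (2 * K)"
      and d2: "\<forall>t\<in>{0..T}. \<forall>s\<in>{0..T}. dist s t < d2 \<longrightarrow> dist (V s) (V t) < e"
      and d3: "\<forall>t\<in>{0..T}. \<forall>s\<in>{0..T}. dist s t < d3 \<longrightarrow> dist (G s) (G t) < e / c"
      using ux[unfolded uniformly_continuous_on_def, rule_format, of "e / (2 * K)"]
        uV[unfolded uniformly_continuous_on_def, rule_format, of e]
        uG[unfolded uniformly_continuous_on_def, rule_format, of "e / c"] e by blast
    define d where "d = min d1 (min d2 d3)"
    have "exp (- G b) * V b - H b - (exp (- G a) * V a - H a) \<le> e * (2 * G b + M b - (2 * G a + M a))"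
      if ab: "0 \<le> a" "a \<le> b" "b \<le> T" "b - a < d" for a b
    proof -
      have near: "dist s t < d1" "dist s t < d2" "dist s t < d3" if "s \<in> {a..b}" "t \<in> {a..b}" for s t
        using that ab by (auto simp: d_def dist_real_def)
      have inT: "s \<in> {0..T}" if "s \<in> {a..b}" for s using that ab by auto
      have f_int: "f integrable_on {0..T}" using x[of T] T by blast
      have xba: "x b - x a = integral {a..b} f"
        using incr(1)[OF f_int ab(1-3)] x[of a] x[of b] ab by (simp add: integral_unique)
      have "x b \<bullet> R (x a) = x a \<bullet> R (x b)" using R_sym[of "x b" "x a"] by (simp add: inner_commute)
      then have "V b - V a = (x b - x a) \<bullet> R (x a + x b)"
        by (simp add: V_def linear_add[OF R] inner_add_right inner_diff_left)
      also have "\<dots> = integral {a..b} (\<lambda>s. f s \<bullet> R (x a + x b))"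
        unfolding xba using incr(2)[OF f_int ab(1-3)]
        by (simp add: integral_linear[OF _ bounded_linear_inner_left, unfolded o_def])
      also have "\<dots> \<le> integral {a..b} (\<lambda>s. h s + (V b + e) * g s + e * m s)"
      proof (rule integral_le)
        show "(\<lambda>s. f s \<bullet> R (x a + x b)) integrable_on {a..b}"
          using integrable_linear[OF incr(2)[OF f_int ab(1-3)] bounded_linear_inner_left] by (simp add: o_def)
        show "(\<lambda>s. h s + (V b + e) * g s + e * m s) integrable_on {a..b}"
          using incr(2)[OF g(1) ab(1-3)] incr(2)[OF h(1) ab(1-3)] incr(2)[OF m(1) ab(1-3)]
          by (intro integrable_add integrable_on_mult_right) auto
        fix s assume s: "s \<in> {a..b}"
        have ends: "a \<in> {a..b}" "b \<in> {a..b}" using ab by auto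
        \<comment> \<open>By this choice \<open>x a + x b = 2 * x s + z\<close>, so the dissipation
          bound applies at \<open>s\<close> and only \<open>R z\<close> is an error.\<close>
        define z where "z = (x a - x s) + (x b - x s)"
        have "norm z \<le> norm (x a - x s) + norm (x b - x s)" unfolding z_def by (rule norm_triangle_ineq)
        also have "\<dots> \<le> e / (2 * K) + e / (2 * K)"
          using d1[rule_format, OF inT[OF s] inT[OF ends(1)] near(1)[OF ends(1) s]]
            d1[rule_format, OF inT[OF s] inT[OF ends(2)] near(1)[OF ends(2) s]] by (simp add: dist_norm)
        finally have "norm z \<le> e / K" using K(1) by (simp add: field_simps)
        then have "norm (R z) \<le> e" using K(2)[of z] K(1) by (simp add: field_simps)
        then have "f s \<bullet> R z \<le> m s * e"
          using norm_cauchy_schwarz[of "f s" "R z"] mult_mono[OF m(2)[OF inT[OF s]] \<open>norm (R z) \<le> e\<close>]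
            norm_ge_zero[of "f s"] m(2)[OF inT[OF s]] by (smt (verit) norm_ge_zero)
        moreover have "f s \<bullet> R (x a + x b) = 2 * (f s \<bullet> R (x s)) + f s \<bullet> R z"
          by (simp add: z_def linear_add[OF R] linear_diff[OF R] inner_add_right inner_diff_right)
        moreover have "g s * V s \<le> g s * (V b + e)"
          using d2[rule_format, OF inT[OF ends(2)] inT[OF s] near(2)[OF s ends(2)]] g(2)[of s]
          by (intro mult_left_mono) (auto simp: dist_real_def)
        ultimately show "f s \<bullet> R (x a + x b) \<le> h s + (V b + e) * g s + e * m s"
          using diss[OF inT[OF s]] by (simp add: V_def mult.commute)
      qed
      also have "\<dots> = (H b - H a) + (V b + e) * (G b - G a) + e * (M b - M a)"
        unfolding H_def G_def M_def incr(1)[OF g(1) ab(1-3)] incr(1)[OF h(1) ab(1-3)] incr(1)[OF m(1) ab(1-3)]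
        using incr(2)[OF g(1) ab(1-3)] incr(2)[OF h(1) ab(1-3)] incr(2)[OF m(1) ab(1-3)]
        by (simp add: integral_add integrable_add integrable_on_mult_right)
      finally have V_incr: "V b - V a \<le> (H b - H a) + (V b + e) * (G b - G a) + e * (M b - M a)" .
      define \<gamma> where "\<gamma> = G b - G a"
      have \<gamma>: "0 \<le> \<gamma>" unfolding \<gamma>_def G_def incr(1)[OF g(1) ab(1-3)]
        using g(2) by (intro integral_nonneg incr(2)[OF g(1) ab(1-3)]) auto
      have H_mono: "0 \<le> H b - H a" unfolding H_def incr(1)[OF h(1) ab(1-3)]
        using h(2) by (intro integral_nonneg incr(2)[OF h(1) ab(1-3)]) auto
      have M_mono: "0 \<le> M b - M a" unfolding M_def incr(1)[OF m(1) ab(1-3)]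
        using order_trans[OF norm_ge_zero m(2)[OF inT]] by (intro integral_nonneg incr(2)[OF m(1) ab(1-3)]) auto
      have "\<bar>\<gamma>\<bar> < e / c"
        using d3[rule_format, of a b] near(3)[of b a] ab by (auto simp: \<gamma>_def dist_real_def)
      then have "\<gamma> * c \<le> e" using \<gamma> c(1) by (simp add: field_simps)
      then have \<gamma>V: "\<gamma> * V b \<le> e" using mult_left_mono[OF c(2)[of b] \<gamma>] ab by auto
      have "exp (- \<gamma>) * V b \<le> (1 - \<gamma> + \<gamma>\<^sup>2) * V b"
        by (rule mult_right_mono[OF exp_minus_le_quadratic[OF \<gamma>] V0])
      also have "\<dots> = V b - \<gamma> * V b + \<gamma> * (\<gamma> * V b)" by (simp add: power2_eq_square algebra_simps)
      also have "\<gamma> * (\<gamma> * V b) \<le> \<gamma> * e" by (rule mult_left_mono[OF \<gamma>V \<gamma>])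
      finally have "exp (- \<gamma>) * V b - V a \<le> (H b - H a) + e * (2 * \<gamma> + (M b - M a))"
        using V_incr by (simp add: \<gamma>_def[symmetric] algebra_simps)
      then have "exp (- G a) * (exp (- \<gamma>) * V b - V a)
          \<le> exp (- G a) * ((H b - H a) + e * (2 * \<gamma> + (M b - M a)))"
        by (intro mult_left_mono) auto
      also have "\<dots> \<le> 1 * ((H b - H a) + e * (2 * \<gamma> + (M b - M a)))"
      proof (rule mult_right_mono)
        have "0 \<le> G a" unfolding G_def using g(2) incr(2)[OF g(1), of 0 a] ab by (intro integral_nonneg) auto
        then show "exp (- G a) \<le> 1" by simp
        show "0 \<le> (H b - H a) + e * (2 * \<gamma> + (M b - M a))" using H_mono M_mono \<gamma> e by simp
      qed
      also have "exp (- G a) * (exp (- \<gamma>) * V b - V a) = exp (- G b) * V b - exp (- G a) * V a"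
        by (simp add: \<gamma>_def right_diff_distrib mult.assoc[symmetric] exp_add[symmetric])
      finally show ?thesis by (simp add: \<gamma>_def algebra_simps)
    qed
    moreover have "0 < d" using d by (simp add: d_def)
    ultimately show "\<exists>d>0. \<forall>s t. 0 \<le> s \<and> s \<le> t \<and> t \<le> T \<and> t - s < d \<longrightarrow>
        exp (- G t) * V t - H t - (exp (- G s) * V s - H s) \<le> e * (2 * G t + M t - (2 * G s + M s))"
      by blast
  qed (rule T)
  \<comment> \<open>The integral over the degenerate interval vanishes, so the initial value of the
    decreasing quantity is 0.\<close>
  moreover have "x 0 = 0" using x[of 0] T has_integral_unique[OF _ has_integral_refl(2)] by fastforce
  ultimately have "exp (- G T) * V T \<le> H T" by (simp add: V_def H_def linear_0[OF R])
  then have "exp (G T) * (exp (- G T) * V T) \<le> exp (G T) * H T" by (intro mult_left_mono) auto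
  then show ?thesis by (simp add: mult.assoc[symmetric] exp_add[symmetric] V_def G_def H_def)
qed


text \<open>The Lyapunov function is the form of the inverse \<open>R\<close> of \<open>P\<close>.
  With \<open>w = R (x s)\<close>, the squares of \<open>u s - B' w\<close> and, in the form of
  \<open>P\<close>, of \<open>N' k w - u s $ k *\<^sub>R w\<close> are nonnegative; the Lyapunov
  inequality absorbs their remaining terms. Only controls in \<open>J\<close> contribute to the
  exponential rate.\<close>

lemma bilinear_state_bound:
  fixes A A' P :: "'a::euclidean_space \<Rightarrow> 'a" and N N' :: "'m::finite \<Rightarrow> 'a \<Rightarrow> 'a"
    and B :: "real^'m \<Rightarrow> 'a" and u :: "real \<Rightarrow> real^'m"
  assumes T: "0 \<le> T"
    and A: "linear A" "\<And>v w. A v \<bullet> w = v \<bullet> A' w"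
    and N: "\<And>k. linear (N k)" "\<And>k v w. N k v \<bullet> w = v \<bullet> N' k w"
    and B: "linear B" "\<And>v w. B v \<bullet> w = v \<bullet> B' w"
    and P: "linear P" "\<And>v w. v \<bullet> P w = P v \<bullet> w" and P_pos: "\<And>w. w \<noteq> 0 \<Longrightarrow> 0 < w \<bullet> P w"
    and lyap: "\<And>w. lyap_form A' N' P w \<le> - (norm (B' w))\<^sup>2"
    and x: "\<And>t. 0 \<le> t \<Longrightarrow> t \<le> T \<Longrightarrow>
      ((\<lambda>s. A (x s) + B (u s) + (\<Sum>k\<in>UNIV. u s $ k *\<^sub>R N k (x s))) has_integral x t) {0..t}"
    and J: "\<And>k v. k \<notin> J \<Longrightarrow> N k v = 0"
    and u: "(\<lambda>s. (norm (u s))\<^sup>2) integrable_on {0..T}"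
    and uJ: "(\<lambda>s. \<Sum>k\<in>J. (u s $ k)\<^sup>2) integrable_on {0..T}"
  shows "(v \<bullet> x T)\<^sup>2 \<le> (v \<bullet> P v) *
    (exp (integral {0..T} (\<lambda>s. \<Sum>k\<in>J. (u s $ k)\<^sup>2)) * integral {0..T} (\<lambda>s. (norm (u s))\<^sup>2))"
proof -
  let ?f = "\<lambda>s. A (x s) + B (u s) + (\<Sum>k\<in>UNIV. u s $ k *\<^sub>R N k (x s))"
  have psd: "0 \<le> w \<bullet> P w" for w using P_pos[of w] by (cases "w = 0") auto
  have "inj P" unfolding linear_injective_0[OF P(1)] using P_pos by force
  then obtain R where R: "linear R" "\<And>v. R (P v) = v" "\<And>v. P (R v) = v"
    using linear_injective_isomorphism[OF P(1)] by blast
  have R_sym: "v \<bullet> R w = R v \<bullet> w" for v w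
    using P(2)[of "R v" "R w"] by (simp add: R)
  have R_psd: "0 \<le> v \<bullet> R v" for v using psd[of "R v"] by (simp add: R inner_commute)
  have cont_x: "continuous_on {0..T} x" using x by (rule indefinite_integral_continuous_on)
  obtain c where c: "0 \<le> c" "\<And>s. s \<in> {0..T} \<Longrightarrow> norm (x s) \<le> c"
  proof -
    have "bounded (x ` {0..T})" using cont_x by (intro compact_imp_bounded compact_continuous_image) auto
    then obtain c where "0 < c" "\<forall>y\<in>x ` {0..T}. norm y \<le> c" by (auto simp: bounded_pos)
    then show thesis by (intro that[of c]) auto
  qed
  obtain a where a: "0 < a" "\<And>v. norm (A v) \<le> a * norm v" using linear_bounded_pos[OF A(1)] by blast
  obtain b where b: "0 < b" "\<And>v. norm (B v) \<le> b * norm v" using linear_bounded_pos[OF B(1)] by blast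
  have "\<exists>n>0. \<forall>v. norm (N k v) \<le> n * norm v" for k using linear_bounded_pos[OF N(1)] by blast
  then have "\<exists>n. \<forall>k. 0 < n k \<and> (\<forall>v. norm (N k v) \<le> n k * norm v)" by (intro choice) blast
  then obtain n where n: "\<And>k. 0 < n k" "\<And>k v. norm (N k v) \<le> n k * norm v" by blast
  \<comment> \<open>The velocity grows linearly in the input, and
    \<open>norm (u s) \<le> 1 + (norm (u s))^2\<close> makes square integrability enough for an
    integrable majorant.\<close>
  define m where "m = (\<lambda>s. a * c + (b + (\<Sum>k\<in>UNIV. n k * c)) * (1 + (norm (u s))\<^sup>2))"
  have f_le: "norm (?f s) \<le> m s" if s: "s \<in> {0..T}" for s
  proof -
    have "norm (?f s) \<le> norm (A (x s)) + norm (B (u s)) + (\<Sum>k\<in>UNIV. norm (u s $ k *\<^sub>R N k (x s)))"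
      by (intro norm_triangle_le add_mono norm_triangle_ineq norm_sum)
    also have "\<dots> \<le> a * c + b * norm (u s) + (\<Sum>k\<in>UNIV. n k * c * norm (u s))"
    proof (intro add_mono sum_mono)
      show "norm (A (x s)) \<le> a * c"
        using a(2)[of "x s"] mult_left_mono[OF c(2)[OF s], of a] a(1) by linarith
      show "norm (u s $ k *\<^sub>R N k (x s)) \<le> n k * c * norm (u s)" for k
      proof -
        have "norm (N k (x s)) \<le> n k * c"
          using n(2)[of k "x s"] mult_left_mono[OF c(2)[OF s], of "n k"] n(1)[of k] by linarith
        then have "\<bar>u s $ k\<bar> * norm (N k (x s)) \<le> norm (u s) * (n k * c)"
          using component_le_norm_cart[of "u s" k] by (intro mult_mono) auto
        then show ?thesis by (simp add: mult_ac)
      qed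
    qed (rule b(2))
    also have "\<dots> = a * c + (b + (\<Sum>k\<in>UNIV. n k * c)) * norm (u s)"
      by (simp add: sum_distrib_right distrib_right)
    also have "\<dots> \<le> m s" unfolding m_def
    proof (intro add_left_mono mult_left_mono)
      have "0 \<le> (norm (u s) - 1)\<^sup>2 + norm (u s)" by simp
      then show "norm (u s) \<le> 1 + (norm (u s))\<^sup>2" by (simp add: power2_eq_square algebra_simps)
      have "0 \<le> (\<Sum>k\<in>UNIV. n k * c)" using n(1) c(1) by (intro sum_nonneg mult_nonneg_nonneg) (auto intro: less_imp_le)
      then show "0 \<le> b + (\<Sum>k\<in>UNIV. n k * c)" using b(1) by simp
    qed
    finally show ?thesis .
  qed
  have m_int: "m integrable_on {0..T}" unfolding m_def
    by (intro integrable_add integrable_on_mult_right u) auto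
  have diss: "2 * (?f s \<bullet> R (x s)) \<le> (norm (u s))\<^sup>2 + (\<Sum>k\<in>J. (u s $ k)\<^sup>2) * (x s \<bullet> R (x s))" for s
  proof -
    define w where "w = R (x s)"
    have xs: "x s = P w" by (simp add: w_def R)
    have "2 * (B (u s) \<bullet> w) \<le> (norm (u s))\<^sup>2 + (norm (B' w))\<^sup>2"
    proof -
      have "0 \<le> (norm (u s - B' w))\<^sup>2" by simp
      then show ?thesis
        by (simp add: B(2) power2_norm_eq_inner inner_diff_left inner_diff_right
            inner_commute[of "B' w" "u s"])
    qed
    moreover have "2 * (u s $ k * (N k (P w) \<bullet> w))
        \<le> N' k w \<bullet> P (N' k w) + (if k \<in> J then (u s $ k)\<^sup>2 * (w \<bullet> P w) else 0)" for k
    proof (cases "k \<in> J")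
      case True
      have "N k (P w) \<bullet> w = w \<bullet> P (N' k w)" by (simp add: N(2) P(2))
      moreover have "N' k w \<bullet> P w = w \<bullet> P (N' k w)" by (simp add: P(2) inner_commute)
      moreover have "0 \<le> (N' k w - u s $ k *\<^sub>R w) \<bullet> P (N' k w - u s $ k *\<^sub>R w)" by (rule psd)
      ultimately show ?thesis using True
        by (simp add: linear_diff[OF P(1)] linear_cmul[OF P(1)] inner_diff_left inner_diff_right
            power2_eq_square algebra_simps)
    qed (simp add: J psd)
    then have "(\<Sum>k\<in>UNIV. 2 * (u s $ k * (N k (P w) \<bullet> w)))
        \<le> (\<Sum>k\<in>UNIV. N' k w \<bullet> P (N' k w) + (if k \<in> J then (u s $ k)\<^sup>2 * (w \<bullet> P w) else 0))"
      by (rule sum_mono)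
    then have "2 * (\<Sum>k\<in>UNIV. u s $ k * (N k (P w) \<bullet> w))
        \<le> (\<Sum>k\<in>UNIV. N' k w \<bullet> P (N' k w)) + (\<Sum>k\<in>J. (u s $ k)\<^sup>2) * (w \<bullet> P w)"
      by (simp add: sum.distrib sum_distrib_left sum_distrib_right sum.If_cases)
    moreover have "A (P w) \<bullet> w = A' w \<bullet> P w" using A(2)[of "P w" w] by (simp add: inner_commute[of "P w"])
    moreover have "2 * (A' w \<bullet> P w) + (\<Sum>k\<in>UNIV. N' k w \<bullet> P (N' k w)) \<le> - (norm (B' w))\<^sup>2"
      using lyap[of w] by (simp add: lyap_form_def)
    ultimately show ?thesis
      unfolding xs R(2) by (simp add: inner_add_left inner_sum_left inner_commute[of "P w" w])
  qed
  have "x T \<bullet> R (x T) \<le> exp (integral {0..T} (\<lambda>s. \<Sum>k\<in>J. (u s $ k)\<^sup>2)) * integral {0..T} (\<lambda>s. (norm (u s))\<^sup>2)"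
    by (rule gronwall_quadratic_form[OF T x R(1) R_sym R_psd m_int f_le uJ _ u _ diss])
      (auto intro: sum_nonneg)
  then have "(v \<bullet> P v) * (x T \<bullet> R (x T)) \<le> (v \<bullet> P v) *
      (exp (integral {0..T} (\<lambda>s. \<Sum>k\<in>J. (u s $ k)\<^sup>2)) * integral {0..T} (\<lambda>s. (norm (u s))\<^sup>2))"
    using psd by (rule mult_left_mono)
  \<comment> \<open>Since \<open>x T = P (R (x T))\<close>, Cauchy-Schwarz for the form of
    \<open>P\<close> brings in exactly the Lyapunov function.\<close>
  moreover have "(v \<bullet> x T)\<^sup>2 \<le> (v \<bullet> P v) * (x T \<bullet> R (x T))"
    using psd_cauchy_schwarz[OF P psd, of v "R (x T)"] by (simp add: R inner_commute)
  ultimately show ?thesis by linarith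
qed


section \<open>Singular perturbation approximation\<close>

lemma sum_UNIV_Plus:
  fixes f :: "'r::finite + 's::finite \<Rightarrow> 'b::comm_monoid_add"
  shows "(\<Sum>i\<in>UNIV. f i) = (\<Sum>i\<in>UNIV. f (Inl i)) + (\<Sum>i\<in>UNIV. f (Inr i))"
  by (simp add: UNIV_Plus_UNIV[symmetric] sum.Plus del: UNIV_Plus_UNIV)

lemma inner_rows: "X \<bullet> Y = rows1 X \<bullet> rows1 Y + rows2 X \<bullet> rows2 (Y :: real^'c^('r::finite + 's::finite))"
  by (simp add: inner_vec_def rows1_def rows2_def sum_UNIV_Plus)

lemma transpose_mult_rows:
  "transpose X ** Y = transpose (rows1 X) ** rows1 Y
     + transpose (rows2 X) ** rows2 (Y :: real^'c^('r::finite + 's::finite))"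
  by (simp add: matrix_matrix_mult_def transpose_def rows1_def rows2_def sum_UNIV_Plus vec_eq_iff)

lemma rows1_mult_blk: "rows1 (M ** X) = blk11 M ** rows1 X + blk12 M ** rows2 X"
  by (simp add: matrix_matrix_mult_def rows1_def rows2_def blk11_def blk12_def sum_UNIV_Plus vec_eq_iff)

lemma rows2_mult_blk: "rows2 (M ** X) = blk21 M ** rows1 X + blk22 M ** rows2 X"
  by (simp add: matrix_matrix_mult_def rows1_def rows2_def blk21_def blk22_def sum_UNIV_Plus vec_eq_iff)

lemma rows1_mult: "rows1 (X ** Y) = rows1 X ** Y"
  by (simp add: matrix_matrix_mult_def rows1_def vec_eq_iff)

lemma mult_cols: "X ** Y = cols1 X ** rows1 Y + cols2 X ** rows2 Y"
  by (simp add: matrix_matrix_mult_def rows1_def rows2_def cols1_def cols2_def sum_UNIV_Plus vec_eq_iff)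

lemma rows1_add: "rows1 (X + Y) = rows1 X + rows1 Y"
  by (simp add: rows1_def vec_eq_iff)

lemma rows1_uminus: "rows1 (- X) = - rows1 (X :: real^'c^('r::finite + 's::finite))"
  by (simp add: rows1_def vec_eq_iff)

lemma rows1_sum: "rows1 (\<Sum>k\<in>S. X k) = (\<Sum>k\<in>S. rows1 (X k))"
  by (simp add: rows1_def vec_eq_iff)

lemma blk_diagm:
  "blk11 (diagm d) = diagm (d \<circ> Inl)" "blk12 (diagm d) = 0"
  "blk21 (diagm d) = 0" "blk22 (diagm d) = diagm (d \<circ> Inr)"
  by (simp_all add: blk11_def blk12_def blk21_def blk22_def diagm_def vec_eq_iff)

lemma transpose_diagm: "transpose (diagm d) = diagm d"
  by (simp add: transpose_def diagm_def vec_eq_iff)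

lemma inner_diagm: "diagm d \<bullet> X = (\<Sum>i\<in>UNIV. d i * X $ i $ i)"
  by (simp add: inner_vec_def diagm_def if_distrib[of "\<lambda>c. c * _"] cong: if_cong)

lemma trace_diagm_mult: "trace (diagm d ** X) = diagm d \<bullet> X"
  unfolding inner_diagm trace_def
  by (simp add: matrix_matrix_mult_def diagm_def if_distrib[of "\<lambda>c. c * _"] cong: if_cong)

lemma inner_diagm_rows:
  "diagm d \<bullet> (X ** transpose X) = diagm (d \<circ> Inl) \<bullet> (rows1 X ** transpose (rows1 X))
     + diagm (d \<circ> Inr) \<bullet> (rows2 X ** transpose (rows2 X))"
  by (simp add: inner_diagm sum_UNIV_Plus matrix_matrix_mult_def transpose_def rows1_def rows2_def)

lemma matrix_vector_diagm_pos:
  assumes "\<forall>i. 0 < d i" and "w \<noteq> 0"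
  shows "0 < w \<bullet> (diagm d *v w)"
proof -
  have eq: "w \<bullet> (diagm d *v w) = (\<Sum>i\<in>UNIV. d i * (w $ i)\<^sup>2)"
    by (simp add: inner_vec_def matrix_vector_mult_def diagm_def if_distrib[of "\<lambda>c. c * _"]
        power2_eq_square mult.left_commute cong: if_cong)
  obtain i where "w $ i \<noteq> 0" using assms(2) by (auto simp: vec_eq_iff)
  then have "0 < d i * (w $ i)\<^sup>2" using assms(1) by simp
  also have "\<dots> \<le> (\<Sum>i\<in>UNIV. d i * (w $ i)\<^sup>2)"
    using assms(1) by (intro member_le_sum) (simp_all add: less_imp_le)
  finally show ?thesis using eq by simp
qed

text \<open>The embedding of the reduced state space onto the states with \<open>A\<^sub>2\<^sub>1 x\<^sub>1 + A\<^sub>2\<^sub>2 x\<^sub>2 = 0\<close>;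
  all reduced matrices arise by composing the full ones with it.\<close>
definition spaT :: "real^('r::finite + 's::finite)^('r + 's) \<Rightarrow> real^'r^('r + 's)" where
  "spaT A = (\<chi> i. case i of Inl a \<Rightarrow> mat 1 $ a | Inr b \<Rightarrow> (- (matrix_inv (blk22 A) ** blk21 A)) $ b)"

lemma rows_spaT: "rows1 (spaT A) = mat 1" "rows2 (spaT A) = - (matrix_inv (blk22 A) ** blk21 A)"
  by (simp_all add: rows1_def rows2_def spaT_def vec_eq_iff)

lemma matrix_mult_uminus_right: "X ** (- Y) = - (X ** (Y :: real^'c^'d))"
  by (simp add: matrix_matrix_mult_def vec_eq_iff sum_negf)

lemma matrix_mult_uminus_left: "(- X) ** Y = - (X ** (Y :: real^'c^'d))"
  by (simp add: matrix_matrix_mult_def vec_eq_iff sum_negf)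

lemma spaC_eq: "spaC C A = C ** spaT A"
  by (simp add: mult_cols[of C] rows_spaT spaC_def matrix_mult_uminus_right matrix_mul_assoc)

lemma rows_mult_spaT:
  "rows1 (M ** spaT A) = blk11 M - blk12 M ** matrix_inv (blk22 A) ** blk21 A"
  "rows2 (M ** spaT A) = blk21 M - blk22 M ** matrix_inv (blk22 A) ** blk21 A"
  by (simp_all add: rows1_mult_blk rows2_mult_blk rows_spaT matrix_mult_uminus_right matrix_mul_assoc)

lemma matrix_inv_right: "invertible X \<Longrightarrow> X ** matrix_inv X = mat 1"
  unfolding invertible_def matrix_inv_def by (rule someI2_ex) auto

text \<open>The second block is \<open>A21 - A22 A22^-1 A21\<close>: the embedding satisfies the
  algebraic constraint of the approximation.\<close>

lemma rows_state_spaT: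
  assumes "invertible (blk22 A)"
  shows "rows1 (A ** spaT A) = spaA A" "rows2 (A ** spaT A) = 0"
  using assms by (simp_all add: rows_mult_spaT spaA_def matrix_inv_right)

lemma rows_bilinear_spaT:
  "rows1 (N k ** spaT A) = spaN N A k" "rows2 (N k ** spaT A) = spaM N A k"
  by (simp_all add: rows_mult_spaT spaN_def spaM_def)

lemma matrix_mult_sum_left: "(\<Sum>k\<in>S. X k) ** Y = (\<Sum>k\<in>S. X k ** (Y :: real^'c^'d))"
  by (induction S rule: infinite_finite_induct) (auto simp: matrix_add_rdistrib)

lemma matrix_mult_sum_right: "Y ** (\<Sum>k\<in>S. X k) = (\<Sum>k\<in>S. (Y :: real^'d^'e) ** X k)"
  by (induction S rule: infinite_finite_induct) (auto simp: matrix_add_ldistrib)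

text \<open>Compress the observability equation by \<open>spaT A\<close> on both sides.
  \<open>A ** spaT A\<close> has no second block row, so only the bilinear terms see the second
  block of \<open>diagm \<sigma>\<close>, through \<open>spaM\<close>.\<close>

lemma reduced_gramQ:
  fixes A :: "real^('r::finite + 's::finite)^('r + 's)" and N :: "'m::finite \<Rightarrow> real^('r + 's)^('r + 's)"
  assumes gramQ: "transpose A ** diagm \<sigma> + diagm \<sigma> ** A
      + (\<Sum>k\<in>UNIV. transpose (N k) ** diagm \<sigma> ** N k) = - (transpose C ** C)"
    and inv: "invertible (blk22 A)"
  shows "lyap_op (transpose (spaA A)) (\<lambda>k. transpose (spaN N A k)) (diagm (\<sigma> \<circ> Inl))
    = - (transpose (spaC C A) ** spaC C A)
      - (\<Sum>k\<in>UNIV. transpose (spaM N A k) ** diagm (\<sigma> \<circ> Inr) ** spaM N A k)"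
proof -
  let ?T = "spaT A" and ?S = "diagm \<sigma>" and ?S1 = "diagm (\<sigma> \<circ> Inl)" and ?S2 = "diagm (\<sigma> \<circ> Inr)"
  have S_rows: "rows1 (?S ** X) = ?S1 ** rows1 X" "rows2 (?S ** X) = ?S2 ** rows2 X" for X :: "real^'c^('r + 's)"
    by (simp_all add: rows1_mult_blk rows2_mult_blk blk_diagm)
  have AT: "transpose (A ** ?T) ** (?S ** ?T) = transpose (spaA A) ** ?S1"
    unfolding transpose_mult_rows[of "A ** ?T"] S_rows rows_state_spaT[OF inv] rows_spaT
    by (simp add: transpose_def[of 0] flip: zero_vec_def)
  then have "transpose (?S ** ?T) ** (A ** ?T) = ?S1 ** spaA A"
    by (metis matrix_transpose_mul transpose_transpose transpose_diagm)
  moreover have "transpose (N k ** ?T) ** (?S ** (N k ** ?T))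
      = transpose (spaN N A k) ** ?S1 ** spaN N A k + transpose (spaM N A k) ** ?S2 ** spaM N A k" for k
    unfolding transpose_mult_rows[of "N k ** ?T"] S_rows rows_bilinear_spaT by (simp add: matrix_mul_assoc)
  moreover have "transpose ?T ** (transpose A ** ?S + ?S ** A + (\<Sum>k\<in>UNIV. transpose (N k) ** ?S ** N k)) ** ?T
      = transpose (A ** ?T) ** (?S ** ?T) + transpose (?S ** ?T) ** (A ** ?T)
        + (\<Sum>k\<in>UNIV. transpose (N k ** ?T) ** (?S ** (N k ** ?T)))"
    by (simp add: matrix_add_ldistrib matrix_add_rdistrib matrix_mult_sum_left matrix_mult_sum_right matrix_transpose_mul
        transpose_diagm matrix_mul_assoc)
  moreover have "transpose ?T ** (- (transpose C ** C)) ** ?T = - (transpose (spaC C A) ** spaC C A)"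
    by (simp add: matrix_mult_uminus_left matrix_mult_uminus_right spaC_eq matrix_transpose_mul matrix_mul_assoc)
  ultimately show ?thesis
    unfolding gramQ lyap_op_def using AT by (simp add: sum.distrib algebra_simps)
qed

text \<open>Duality evaluates the three pairings as \<open>b1 + b2\<close>,
  \<open>b1 + p - q\<close> and \<open>b1 - h\<close>. In the combination with weights 1, -2, 1
  every \<open>b1\<close> cancels, leaving the terms of \<open>K_SPA\<close>.\<close>

lemma spa_error_trace:
  fixes A :: "real^('r::finite + 's::finite)^('r + 's)" and N :: "'m::finite \<Rightarrow> real^('r + 's)^('r + 's)"
  assumes gramP: "A ** diagm \<sigma> + diagm \<sigma> ** transpose A
      + (\<Sum>k\<in>UNIV. N k ** diagm \<sigma> ** transpose (N k)) = - (B ** transpose B)"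
    and gramQ: "transpose A ** diagm \<sigma> + diagm \<sigma> ** A
      + (\<Sum>k\<in>UNIV. transpose (N k) ** diagm \<sigma> ** N k) = - (transpose C ** C)"
    and inv: "invertible (blk22 A)"
    and Phat_eq: "lyap_op (spaA A) (spaN N A) Phat = - (spaB B ** transpose (spaB B))"
    and Pg_eq: "A ** Pg + Pg ** transpose (spaA A)
      + (\<Sum>k\<in>UNIV. N k ** Pg ** transpose (spaN N A k)) = - (B ** transpose (spaB B))"
  shows "(transpose C ** C) \<bullet> diagm \<sigma> - 2 * ((transpose C ** spaC C A) \<bullet> Pg)
      + (transpose (spaC C A) ** spaC C A) \<bullet> Phat
    = trace (diagm (\<sigma> \<circ> Inr) ** K_SPA A B N Phat Pg)"
proof -
  let ?T = "spaT A" and ?S = "diagm \<sigma>" and ?S1 = "diagm (\<sigma> \<circ> Inl)" and ?S2 = "diagm (\<sigma> \<circ> Inr)"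
  define W where "W = matrix_inv (blk22 A) ** blk21 A"
  \<comment> \<open>\<open>b1\<close> and \<open>b2\<close> split the input term by blocks;
    \<open>p\<close>, \<open>q\<close> and \<open>h\<close> are the other terms of
    \<open>K_SPA\<close> paired with \<open>?S2\<close>, without their signs and factors 2.\<close>
  define b1 where "b1 = ?S1 \<bullet> (rows1 B ** transpose (rows1 B))"
  define b2 where "b2 = ?S2 \<bullet> (rows2 B ** transpose (rows2 B))"
  define p where "p = ?S2 \<bullet> (rows2 (A ** Pg) ** transpose W)"
  define q where "q = (\<Sum>k\<in>UNIV. ?S2 \<bullet> (rows2 (N k ** Pg) ** transpose (spaM N A k)))"
  define h where "h = (\<Sum>k\<in>UNIV. ?S2 \<bullet> (spaM N A k ** Phat ** transpose (spaM N A k)))"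
  have S_rows: "rows1 (?S ** X) = ?S1 ** rows1 X" "rows2 (?S ** X) = ?S2 ** rows2 X" for X :: "real^'c^('r + 's)"
    by (simp_all add: rows1_mult_blk rows2_mult_blk blk_diagm)

  \<comment> \<open>Balancing enters here: both Gramians are \<open>?S\<close>, so pairing one
    equation with the other solution relates the input and output terms directly.\<close>
  have "lyap_op A N ?S = - (B ** transpose B)" using gramP by (simp add: lyap_op_def)
  moreover have Q: "lyap_op (transpose A) (\<lambda>k. transpose (N k)) ?S = - (transpose C ** C)"
    using gramQ by (simp add: lyap_op_def)
  ultimately have "(transpose C ** C) \<bullet> ?S = ?S \<bullet> (B ** transpose B)"
    using lyap_op_inner[of A N ?S ?S] by (simp add: inner_commute)
  then have full: "(transpose C ** C) \<bullet> ?S = b1 + b2"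
    by (simp add: inner_diagm_rows b1_def b2_def)

  have "(transpose (spaM N A k) ** ?S2 ** spaM N A k) \<bullet> Phat
      = ?S2 \<bullet> (spaM N A k ** Phat ** transpose (spaM N A k))" for k
    using inner_matrix_mult_right[of "transpose (spaM N A k) ** ?S2" "spaM N A k" Phat]
      inner_matrix_mult_left[of "transpose (spaM N A k)" ?S2 "Phat ** transpose (spaM N A k)"]
    by (simp add: matrix_mul_assoc)
  then have hM: "(\<Sum>k\<in>UNIV. transpose (spaM N A k) ** ?S2 ** spaM N A k) \<bullet> Phat = h"
    by (simp add: h_def inner_sum_left)
  \<comment> \<open>The equation for \<open>Phat\<close> is paired with \<open>?S1\<close>, which
    solves the compressed dual equation up to the \<open>spaM\<close> terms collected in
    \<open>h\<close>.\<close>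
  have "- b1 = ?S1 \<bullet> lyap_op (spaA A) (spaN N A) Phat" by (simp add: Phat_eq b1_def spaB_def)
  also have "\<dots> = lyap_op (transpose (spaA A)) (\<lambda>k. transpose (spaN N A k)) ?S1 \<bullet> Phat"
    using lyap_op_inner[of "transpose (spaA A)" "\<lambda>k. transpose (spaN N A k)" ?S1 Phat] by simp
  also have "\<dots> = - ((transpose (spaC C A) ** spaC C A) \<bullet> Phat) - h"
    unfolding reduced_gramQ[OF gramQ inv] by (simp add: inner_diff_left hM)
  finally have red: "(transpose (spaC C A) ** spaC C A) \<bullet> Phat = b1 - h" by simp

  \<comment> \<open>For the mixed term the observability equation is compressed on the right only
    and paired with \<open>Pg\<close>. The \<open>?S1\<close> parts of \<open>c1\<close>,
    \<open>c2\<close> and \<open>c3\<close> reassemble the first block row of the equation for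
    \<open>Pg\<close>; the \<open>?S2\<close> parts give \<open>- p + q\<close>.\<close>
  have "(transpose A ** ?S ** ?T) \<bullet> Pg = (?S ** ?T) \<bullet> (A ** Pg)"
    using inner_matrix_mult_left[of "transpose A" "?S ** ?T" Pg] by (simp add: matrix_mul_assoc)
  also have "\<dots> = ?S1 \<bullet> rows1 (A ** Pg) - p"
    using inner_matrix_mult_right[of ?S2 W "rows2 (A ** Pg)"]
    by (simp add: inner_rows[of "?S ** ?T"] S_rows rows_spaT p_def matrix_mult_uminus_right W_def)
  finally have c1: "(transpose A ** ?S ** ?T) \<bullet> Pg = ?S1 \<bullet> rows1 (A ** Pg) - p" .
  have c2: "(?S ** A ** ?T) \<bullet> Pg = ?S1 \<bullet> rows1 (Pg ** transpose (spaA A))"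
    using inner_matrix_mult_right[of ?S1 "spaA A" "rows1 Pg"]
    by (simp add: inner_rows[of "?S ** (A ** ?T)"] S_rows rows_state_spaT[OF inv] rows1_mult[of Pg]
        matrix_mul_assoc[symmetric])
  have c3: "(transpose (N k) ** ?S ** N k ** ?T) \<bullet> Pg
      = ?S1 \<bullet> rows1 (N k ** Pg ** transpose (spaN N A k))
        + ?S2 \<bullet> (rows2 (N k ** Pg) ** transpose (spaM N A k))" for k
  proof -
    have "(transpose (N k) ** ?S ** N k ** ?T) \<bullet> Pg = (?S ** (N k ** ?T)) \<bullet> (N k ** Pg)"
      using inner_matrix_mult_left[of "transpose (N k)" "?S ** (N k ** ?T)" Pg]
      by (simp add: matrix_mul_assoc)
    also have "\<dots> = (?S1 ** spaN N A k) \<bullet> rows1 (N k ** Pg) + (?S2 ** spaM N A k) \<bullet> rows2 (N k ** Pg)"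
      by (simp add: inner_rows[of "?S ** (N k ** ?T)"] S_rows rows_bilinear_spaT)
    finally show ?thesis
      using inner_matrix_mult_right[of ?S1 "spaN N A k" "rows1 (N k ** Pg)"]
        inner_matrix_mult_right[of ?S2 "spaM N A k" "rows2 (N k ** Pg)"]
      by (simp add: rows1_mult[of "N k ** Pg"])
  qed
  have "- ((transpose C ** spaC C A) \<bullet> Pg) = ((- (transpose C ** C)) ** ?T) \<bullet> Pg"
    by (simp add: spaC_eq matrix_mult_uminus_left matrix_mul_assoc)
  also have "\<dots> = (transpose A ** ?S ** ?T) \<bullet> Pg + (?S ** A ** ?T) \<bullet> Pg
      + (\<Sum>k\<in>UNIV. (transpose (N k) ** ?S ** N k ** ?T) \<bullet> Pg)"
    unfolding gramQ[symmetric]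
    by (simp add: matrix_add_rdistrib matrix_mult_sum_left inner_add_left inner_sum_left)
  also have "\<dots> = ?S1 \<bullet> rows1 (A ** Pg + Pg ** transpose (spaA A)
      + (\<Sum>k\<in>UNIV. N k ** Pg ** transpose (spaN N A k))) - p + q"
    unfolding c1 c2 c3 by (simp add: q_def rows1_add rows1_sum inner_add_right inner_sum_right sum.distrib)
  also have "\<dots> = - b1 - p + q"
    unfolding Pg_eq by (simp add: rows1_uminus rows1_mult[of B] b1_def spaB_def)
  finally have mixed: "(transpose C ** spaC C A) \<bullet> Pg = b1 + p - q" by simp

  have "K_SPA A B N Phat Pg = rows2 B ** transpose (rows2 B) - 2 *\<^sub>R (rows2 (A ** Pg) ** transpose W)
      + 2 *\<^sub>R (\<Sum>k\<in>UNIV. rows2 (N k ** Pg) ** transpose (spaM N A k))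
      - (\<Sum>k\<in>UNIV. spaM N A k ** Phat ** transpose (spaM N A k))"
    by (simp add: K_SPA_def rows2_mult_blk W_def add.commute)
  then have "?S2 \<bullet> K_SPA A B N Phat Pg = b2 - 2 * p + 2 * q - h"
    by (simp add: inner_add_right inner_diff_right inner_sum_right b2_def p_def q_def h_def)
  then show ?thesis unfolding trace_diagm_mult full mixed red by simp
qed


section \<open>The stacked system\<close>

text \<open>Stacked states are pairs: a product of Euclidean spaces is again Euclidean, so the
  estimates for \<open>lyap_form\<close> apply directly.\<close>

definition diag_map :: "real^'a^'c \<Rightarrow> real^'b^'d \<Rightarrow> (real^'a) \<times> (real^'b) \<Rightarrow> (real^'c) \<times> (real^'d)" where
  "diag_map X Y w = (X *v fst w, Y *v snd w)"

definition block_map ::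
  "real^'a^'a \<Rightarrow> real^'b^'a \<Rightarrow> real^'b^'b \<Rightarrow> (real^'a) \<times> (real^'b) \<Rightarrow> (real^'a) \<times> (real^'b)" where
  "block_map S G H w = (S *v fst w + G *v snd w, transpose G *v fst w + H *v snd w)"

lemma linear_diag_map: "linear (diag_map X Y)"
  by (rule linearI) (simp_all add: diag_map_def matrix_vector_right_distrib vec.scale matrix_vector_mult_scaleR)

lemma linear_block_map: "linear (block_map S G H)"
  by (rule linearI)
    (simp_all add: block_map_def matrix_vector_right_distrib matrix_vector_mult_scaleR scaleR_add_right)

lemma diag_map_adjoint: "diag_map X Y v \<bullet> w = v \<bullet> diag_map (transpose X) (transpose Y) w"
  using inner_matrix_vector[of "fst w" X "fst v"] inner_matrix_vector[of "snd w" Y "snd v"]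
  by (simp add: diag_map_def inner_prod_def inner_commute)

lemma block_map_sym:
  assumes "transpose S = S" "transpose H = H"
  shows "v \<bullet> block_map S G H w = block_map S G H v \<bullet> w"
  using inner_matrix_vector[of "fst v" S "fst w"] inner_matrix_vector[of "fst v" G "snd w"]
    inner_matrix_vector[of "snd v" "transpose G" "fst w"] inner_matrix_vector[of "snd v" H "snd w"] assms
  by (simp add: block_map_def inner_prod_def inner_add_left inner_add_right)

text \<open>The off-diagonal blocks are transposes of each other, so they contribute the same
  Sylvester expression twice.\<close>

lemma block_lyap_form:
  assumes S: "transpose S = S" and H: "transpose H = H"
  shows "lyap_form (diag_map (transpose A) (transpose D)) (\<lambda>k. diag_map (transpose (N k)) (transpose (M k)))
      (block_map S G H) w
    = fst w \<bullet> (lyap_op A N S *v fst w)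
      + 2 * (fst w \<bullet> ((A ** G + G ** transpose D + (\<Sum>k\<in>UNIV. N k ** G ** transpose (M k))) *v snd w))
      + snd w \<bullet> (lyap_op D M H *v snd w)"
proof -
  obtain v z where w: "w = (v, z)" by (cases w)
  have G1: "v \<bullet> (X ** G ** transpose Y *v z) = (transpose X *v v) \<bullet> (G *v (transpose Y *v z))" for X Y
    by (simp only: matrix_vector_mul_assoc[symmetric] inner_matrix_vector)
  have G2: "(transpose Y *v z) \<bullet> (transpose G *v (transpose X *v v)) = v \<bullet> (X ** G ** transpose Y *v z)" for X Y
    unfolding G1 using inner_matrix_vector[of "transpose X *v v" G "transpose Y *v z"]
    by (simp add: inner_commute)
  have G3: "(transpose A *v v) \<bullet> (G *v z) = v \<bullet> (A ** G *v z)"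
    using G1[of A "mat 1"] by (simp add: transpose_mat)
  have G4: "(transpose D *v z) \<bullet> (transpose G *v v) = v \<bullet> (G ** transpose D *v z)"
    using G2[of D "mat 1"] by (simp add: transpose_mat)
  have "lyap_form (diag_map (transpose A) (transpose D)) (\<lambda>k. diag_map (transpose (N k)) (transpose (M k)))
      (block_map S G H) w
    = lyap_form ((*v) (transpose A)) (\<lambda>k. (*v) (transpose (N k))) ((*v) S) v
      + 2 * (v \<bullet> (A ** G *v z) + v \<bullet> (G ** transpose D *v z)
             + (\<Sum>k\<in>UNIV. v \<bullet> (N k ** G ** transpose (M k) *v z)))
      + lyap_form ((*v) (transpose D)) (\<lambda>k. (*v) (transpose (M k))) ((*v) H) z"
    unfolding lyap_form_def w
    by (simp add: diag_map_def block_map_def inner_add_right sum.distrib sum_distrib_left G3 G4 G2 G1[symmetric]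
        del: transpose_matrix_vector)
  then show ?thesis
    unfolding w lyap_op_form[OF S, symmetric] lyap_op_form[OF H, symmetric]
    by (simp add: matrix_vector_mult_add_rdistrib matrix_vector_sum_left inner_add_right inner_sum_right)
qed

section \<open>Joint trajectories, active controls and output rows\<close>

lemma has_integral_Pair:
  fixes f :: "real \<Rightarrow> 'a::euclidean_space" and g :: "real \<Rightarrow> 'b::euclidean_space"
  assumes "(f has_integral a) S" "(g has_integral b) S"
  shows "((\<lambda>s. (f s, g s)) has_integral (a, b)) S"
proof -
  have "bounded_linear (\<lambda>v::'a. (v, 0::'b))" "bounded_linear (\<lambda>v::'b. (0::'a, v))"
    by (auto intro!: bounded_linear_Pair bounded_linear_ident bounded_linear_zero)
  then have "((\<lambda>s. (f s, 0::'b)) has_integral (a, 0)) S" "((\<lambda>s. (0::'a, g s)) has_integral (0, b)) S"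
    using has_integral_linear[OF assms(1)] has_integral_linear[OF assms(2)] by (auto simp: o_def)
  from has_integral_add[OF this] show ?thesis by simp
qed

lemma norm_u_zero: "(norm (u_zero N u s))\<^sup>2 = (\<Sum>k\<in>{k. N k \<noteq> 0}. (u s $ k)\<^sup>2)"
proof -
  have "(norm (u_zero N u s))\<^sup>2 = (\<Sum>k\<in>UNIV. if N k \<noteq> 0 then (u s $ k)\<^sup>2 else 0)"
    unfolding power2_norm_eq_inner inner_vec_def u_zero_def by (auto intro: sum.cong simp: power2_eq_square)
  then show ?thesis by (simp add: sum.If_cases)
qed

text \<open>Integrability of the full squared norm does not pass to a subset of components by
  itself; measurability of \<open>u\<close> together with domination by that norm gives it.\<close>

lemma u_zero_square_integrable:
  fixes u :: "real \<Rightarrow> real^'m"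
  assumes "in_L2 u"
  shows "(\<lambda>s. (norm (u_zero N u s))\<^sup>2) integrable_on {0..}"
proof -
  let ?g = "\<lambda>v::real^'m. (\<Sum>k\<in>{k. N k \<noteq> 0}. (v $ k)\<^sup>2)"
  have eq: "(\<lambda>s. (norm (u_zero N u s))\<^sup>2) = ?g \<circ> u" by (simp add: norm_u_zero fun_eq_iff)
  have "(?g \<circ> u) measurable_on {0..}"
    using assms unfolding in_L2_def
    by (intro measurable_on_compose_continuous_0 continuous_intros) auto
  then have "(?g \<circ> u) \<in> borel_measurable (lebesgue_on {0..})"
    by (rule measurable_on_imp_borel_measurable_lebesgue) auto
  moreover have "norm ((?g \<circ> u) s) \<le> (norm (u s))\<^sup>2" for s
  proof -
    have "?g (u s) \<le> (\<Sum>k\<in>UNIV. (u s $ k)\<^sup>2)" by (intro sum_mono2) auto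
    moreover have "(norm (u s))\<^sup>2 = (\<Sum>k\<in>UNIV. (u s $ k)\<^sup>2)"
      unfolding power2_norm_eq_inner inner_vec_def by (simp add: power2_eq_square)
    ultimately show ?thesis by (simp add: sum_nonneg)
  qed
  ultimately have "(?g \<circ> u) absolutely_integrable_on {0..}"
    using assms unfolding in_L2_def
    by (intro measurable_bounded_by_integrable_imp_absolutely_integrable[where g = "\<lambda>s. (norm (u s))\<^sup>2"]) auto
  then show ?thesis unfolding eq by (rule set_lebesgue_integral_eq_integral(1))
qed

text \<open>Summing the outer products of corresponding rows gives \<open>transpose X ** Y\<close>;
  this collects the scalar output bounds into a trace.\<close>

lemma sum_rows_inner: "(\<Sum>i\<in>UNIV. row i X \<bullet> (M *v row i Y)) = (transpose X ** Y) \<bullet> (M :: real^'a^'b)"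
proof -
  have "(\<Sum>i\<in>UNIV. row i X \<bullet> (M *v row i Y)) = (\<Sum>i\<in>UNIV. \<Sum>a\<in>UNIV. \<Sum>b\<in>UNIV. X $ i $ a * Y $ i $ b * M $ a $ b)"
    by (simp add: inner_vec_def matrix_vector_mult_def row_def sum_distrib_left mult_ac)
  also have "\<dots> = (\<Sum>a\<in>UNIV. \<Sum>i\<in>UNIV. \<Sum>b\<in>UNIV. X $ i $ a * Y $ i $ b * M $ a $ b)"
    by (rule sum.swap)
  also have "\<dots> = (\<Sum>a\<in>UNIV. \<Sum>b\<in>UNIV. \<Sum>i\<in>UNIV. X $ i $ a * Y $ i $ b * M $ a $ b)"
    by (intro sum.cong refl sum.swap)
  also have "\<dots> = (transpose X ** Y) \<bullet> M"
    by (simp add: inner_vec_def matrix_matrix_mult_def transpose_def sum_distrib_right)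
  finally show ?thesis .
qed


theorem theorem5p2:
  fixes A :: "real^('r::finite + 's::finite)^('r + 's)"
    and B :: "real^('m::finite)^('r + 's)"
    and C :: "real^('r + 's)^('p::finite)"
    and N :: "'m \<Rightarrow> real^('r + 's)^('r + 's)"
    and \<sigma> :: "'r + 's \<Rightarrow> real"
    and Phat :: "real^'r^'r"
    and Pg :: "real^'r^('r + 's)"
    and u :: "real \<Rightarrow> real^'m"
    and x :: "real \<Rightarrow> real^('r + 's)"
    and xhat :: "real \<Rightarrow> real^'r"
  assumes stable: "cspectrum (kron_op A N) \<subseteq> {z. Re z < 0}"
    and sigma_pos: "\<forall>i. \<sigma> i > 0"
    and gramP: "A ** diagm \<sigma> + diagm \<sigma> ** transpose A
                  + (\<Sum>k\<in>UNIV. N k ** diagm \<sigma> ** transpose (N k)) = - (B ** transpose B)"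
    and gramQ: "transpose A ** diagm \<sigma> + diagm \<sigma> ** A
                  + (\<Sum>k\<in>UNIV. transpose (N k) ** diagm \<sigma> ** N k) = - (transpose C ** C)"
    and A22_inv: "invertible (blk22 A)"
    and red_nonsing: "0 \<notin> cspectrum (kron_op (spaA A) (spaN N A))"
    and Phat_eq: "spaA A ** Phat + Phat ** transpose (spaA A)
                  + (\<Sum>k\<in>UNIV. spaN N A k ** Phat ** transpose (spaN N A k))
                  = - (spaB B ** transpose (spaB B))"
    and Pg_eq: "A ** Pg + Pg ** transpose (spaA A)
                  + (\<Sum>k\<in>UNIV. N k ** Pg ** transpose (spaN N A k))
                  = - (B ** transpose (spaB B))"
    and u_L2: "in_L2 u"
    and x_traj: "bilinear_traj A B N u x"
    and xhat_traj: "bilinear_traj (spaA A) (spaB B) (spaN N A) u xhat"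
  shows "\<forall>t\<ge>0. norm (C *v x t - spaC C A *v xhat t)
           \<le> sqrt (trace (diagm (\<sigma> \<circ> Inr) ** K_SPA A B N Phat Pg))
             * exp (0.5 * (L2norm (u_zero N u))^2) * L2norm u"
proof (intro allI impI)
  fix t :: real assume t: "0 \<le> t"
  let ?S = "diagm \<sigma>" and ?A = "spaA A" and ?N = "spaN N A" and ?C = "spaC C A"
  let ?tr = "trace (diagm (\<sigma> \<circ> Inr) ** K_SPA A B N Phat Pg)"
  have inj: "X = 0" if "lyap_op A N X = 0" for X
    using stable by (intro lyap_op_injective[OF _ that]) auto
  have inj_red: "X = 0" if "lyap_op ?A ?N X = 0" for X
    using lyap_op_injective[OF red_nonsing that] .
  have S_eq: "lyap_op A N ?S = - (B ** transpose B)" using gramP by (simp add: lyap_op_def)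
  have H_eq: "lyap_op ?A ?N Phat = - (spaB B ** transpose (spaB B))" using Phat_eq by (simp add: lyap_op_def)
  \<comment> \<open>\<open>Phat\<close> is given only as a solution; its transpose solves the same
    equation, and the reduced nonsingularity makes the two equal.\<close>
  have H_sym: "transpose Phat = Phat"
  proof -
    have "lyap_op ?A ?N (transpose Phat) = lyap_op ?A ?N Phat"
      unfolding transpose_lyap_op[symmetric] H_eq by (simp add: transpose_uminus matrix_transpose_mul)
    then have "lyap_op ?A ?N (transpose Phat - Phat) = 0" by (simp add: linear_diff[OF linear_lyap_op])
    then show ?thesis using inj_red by fastforce
  qed
  have form_BB: "w \<bullet> ((X ** transpose Z) *v v) = (transpose X *v w) \<bullet> (transpose Z *v v)"
    for X :: "real^'m^'a" and Z :: "real^'m^'b" and w v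
    by (simp only: matrix_vector_mul_assoc[symmetric] inner_matrix_vector)

  \<comment> \<open>Strict Lyapunov solutions for both systems\<close>
  have "w \<bullet> (lyap_op A N ?S *v w) \<le> 0" for w
    using form_BB[of w B B w] by (simp add: S_eq matrix_vector_uminus_left)
  then obtain Y1 where Y1: "transpose Y1 = Y1" "\<And>w. w \<noteq> 0 \<Longrightarrow> 0 < w \<bullet> (Y1 *v w)"
    "\<And>w. w \<noteq> 0 \<Longrightarrow> w \<bullet> (lyap_op A N Y1 *v w) < 0"
    using lyap_op_strict_solution[OF inj transpose_diagm matrix_vector_diagm_pos[OF sigma_pos]] by blast
  \<comment> \<open>For the reduced system the known positive object, \<open>?S1\<close>, lives on
    the dual side. It is made strict there and then transferred by duality.\<close>
  obtain Y2 where Y2: "transpose Y2 = Y2" "lyap_op ?A ?N Y2 = - mat 1" "\<And>w. w \<noteq> 0 \<Longrightarrow> 0 < w \<bullet> (Y2 *v w)"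
  proof -
    let ?L = "lyap_op (transpose ?A) (\<lambda>k. transpose (?N k))" and ?S1 = "diagm (\<sigma> \<circ> Inl)"
    have S1_pos: "0 < w \<bullet> (?S1 *v w)" if "w \<noteq> 0" for w
      using matrix_vector_diagm_pos[of "\<sigma> \<circ> Inl" w] sigma_pos that by simp
    have S2_psd: "0 \<le> w \<bullet> (diagm (\<sigma> \<circ> Inr) *v w)" for w
      using matrix_vector_diagm_pos[of "\<sigma> \<circ> Inr" w] sigma_pos by (cases "w = 0") auto
    have S1_le: "w \<bullet> (?L ?S1 *v w) \<le> 0" for w
    proof -
      have "w \<bullet> ((transpose ?C ** ?C) *v w) = (?C *v w) \<bullet> (?C *v w)"
        using inner_matrix_vector[of w "transpose ?C" "?C *v w"] by (simp add: matrix_vector_mul_assoc)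
      moreover have "w \<bullet> ((transpose (spaM N A k) ** diagm (\<sigma> \<circ> Inr) ** spaM N A k) *v w)
          = (spaM N A k *v w) \<bullet> (diagm (\<sigma> \<circ> Inr) *v (spaM N A k *v w))" for k
        using inner_matrix_vector[of w "transpose (spaM N A k)" "diagm (\<sigma> \<circ> Inr) *v (spaM N A k *v w)"]
        by (simp add: matrix_vector_mul_assoc matrix_mul_assoc)
      ultimately have "w \<bullet> (?L ?S1 *v w) = - ((?C *v w) \<bullet> (?C *v w))
          - (\<Sum>k\<in>UNIV. (spaM N A k *v w) \<bullet> (diagm (\<sigma> \<circ> Inr) *v (spaM N A k *v w)))"
        unfolding reduced_gramQ[OF gramQ A22_inv]
        by (simp add: matrix_vector_mult_diff_rdistrib matrix_vector_uminus_left matrix_vector_sum_left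
            inner_diff_right inner_sum_right)
      moreover have "0 \<le> (\<Sum>k\<in>UNIV. (spaM N A k *v w) \<bullet> (diagm (\<sigma> \<circ> Inr) *v (spaM N A k *v w)))"
        by (intro sum_nonneg S2_psd)
      moreover have "0 \<le> (?C *v w) \<bullet> (?C *v w)" by (rule inner_ge_zero)
      ultimately show ?thesis by linarith
    qed
    have inj_dual: "X = 0" if "?L X = 0" for X using lyap_op_dual_injective[OF inj_red that] .
    obtain Y where "transpose Y = Y" "\<And>w. w \<noteq> 0 \<Longrightarrow> 0 < w \<bullet> (Y *v w)"
      "\<And>w. w \<noteq> 0 \<Longrightarrow> w \<bullet> (?L Y *v w) < 0"
      using lyap_op_strict_solution[OF inj_dual transpose_diagm S1_pos S1_le] by blast
    then show thesis using lyap_op_positive_solution[OF inj_red] that by blast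
  qed

  \<comment> \<open>The stacked Gramian and its positivity\<close>
  let ?A' = "diag_map (transpose A) (transpose ?A)"
  let ?N' = "\<lambda>k. diag_map (transpose (N k)) (transpose (?N k))"
  let ?B' = "\<lambda>w. transpose B *v fst w + transpose (spaB B) *v snd w"
  define P where "P = block_map ?S Pg Phat"
  define Y where "Y = block_map Y1 0 Y2"
  have P: "linear P" "\<And>v w. v \<bullet> P w = P v \<bullet> w"
    unfolding P_def by (rule linear_block_map, rule block_map_sym[OF transpose_diagm H_sym])
  have Y: "linear Y" "\<And>v w. v \<bullet> Y w = Y v \<bullet> w"
    unfolding Y_def by (rule linear_block_map, rule block_map_sym[OF Y1(1) Y2(1)])
  \<comment> \<open>The blocks of the Lyapunov expression are minus the products of the two input
    matrices, so they form one negative square.\<close>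
  have P_form: "lyap_form ?A' ?N' P w = - (norm (?B' w))\<^sup>2" for w
  proof -
    have "lyap_form ?A' ?N' P w = fst w \<bullet> ((- (B ** transpose B)) *v fst w)
        + 2 * (fst w \<bullet> ((- (B ** transpose (spaB B))) *v snd w))
        + snd w \<bullet> ((- (spaB B ** transpose (spaB B))) *v snd w)"
      unfolding P_def block_lyap_form[OF transpose_diagm H_sym] S_eq H_eq Pg_eq ..
    also have "\<dots> = - (?B' w \<bullet> ?B' w)"
      by (simp add: matrix_vector_uminus_left form_BB inner_add_left inner_add_right
          inner_commute[of "transpose (spaB B) *v snd w" "transpose B *v fst w"] del: transpose_matrix_vector)
    finally show ?thesis by (simp only: power2_norm_eq_inner)
  qed
  have Y_pos: "0 < w \<bullet> Y w" and Y_neg: "lyap_form ?A' ?N' Y w < 0" if "w \<noteq> 0" for w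
  proof -
    have "0 \<le> fst w \<bullet> (Y1 *v fst w)" "0 \<le> snd w \<bullet> (Y2 *v snd w)"
      using Y1(2)[of "fst w"] Y2(3)[of "snd w"] by (cases "fst w = 0"; cases "snd w = 0"; simp)+
    moreover have "fst w \<noteq> 0 \<or> snd w \<noteq> 0" using that by (simp add: prod_eq_iff)
    moreover have "w \<bullet> Y w = fst w \<bullet> (Y1 *v fst w) + snd w \<bullet> (Y2 *v snd w)"
      by (simp add: Y_def block_map_def inner_prod_def transpose_def[of 0] flip: zero_vec_def)
    ultimately show "0 < w \<bullet> Y w" using Y1(2)[of "fst w"] Y2(3)[of "snd w"] by fastforce
    have "lyap_form ?A' ?N' Y w = fst w \<bullet> (lyap_op A N Y1 *v fst w) - snd w \<bullet> snd w"
      unfolding Y_def block_lyap_form[OF Y1(1) Y2(1)] Y2(2) by (simp add: matrix_vector_uminus_left)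
    moreover have "fst w \<bullet> (lyap_op A N Y1 *v fst w) \<le> 0" using Y1(3)[of "fst w"] by (cases "fst w = 0") auto
    moreover have "0 \<le> snd w \<bullet> snd w" by simp
    ultimately show "lyap_form ?A' ?N' Y w < 0"
      using Y1(3)[of "fst w"] inner_gt_zero_iff[of "snd w"] \<open>fst w \<noteq> 0 \<or> snd w \<noteq> 0\<close> by linarith
  qed
  \<comment> \<open>The block diagonal \<open>Y\<close> is the strict comparison solution that
    transfers positivity to \<open>P\<close>.\<close>
  have P_psd: "0 \<le> w \<bullet> P w" for w
    by (rule lyap_form_psd[OF P Y Y_pos Y_neg]) (simp_all add: P_form)

  \<comment> \<open>State bound by perturbation and passage to the limit\<close>
  let ?J = "{k. N k \<noteq> 0}" and ?z = "\<lambda>s. (x s, xhat s)"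
  define E where "E = exp (integral {0..t} (\<lambda>s. \<Sum>k\<in>?J. (u s $ k)\<^sup>2)) * integral {0..t} (\<lambda>s. (norm (u s))\<^sup>2)"
  \<comment> \<open>The \<open>i\<close>-th row of the error output map from the pair of
    states.\<close>
  define c where "c = (\<lambda>i. (row i C, - row i ?C))"
  have u_int: "(\<lambda>s. (norm (u s))\<^sup>2) integrable_on {0..}" using u_L2 by (simp add: in_L2_def)
  have u_int_t: "(\<lambda>s. (norm (u s))\<^sup>2) integrable_on {0..t}"
    using u_int by (rule integrable_on_subinterval) auto
  have uJ_int: "(\<lambda>s. \<Sum>k\<in>?J. (u s $ k)\<^sup>2) integrable_on {0..}"
    using u_zero_square_integrable[OF u_L2, of N] by (simp add: norm_u_zero)
  have uJ_int_t: "(\<lambda>s. \<Sum>k\<in>?J. (u s $ k)\<^sup>2) integrable_on {0..t}"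
    using uJ_int by (rule integrable_on_subinterval) auto
  have bound_eps: "(v \<bullet> ?z t)\<^sup>2 \<le> (v \<bullet> P v + e * (v \<bullet> Y v)) * E" if "0 < e" for v e
  proof -
    define R where "R = (\<lambda>w. P w + e *\<^sub>R Y w)"
    have "(v \<bullet> ?z t)\<^sup>2 \<le> (v \<bullet> R v) * E"
      unfolding E_def
    proof (rule bilinear_state_bound[OF t linear_diag_map diag_map_adjoint[of A ?A]
          linear_diag_map diag_map_adjoint[where X = "N _" and Y = "?N _"],
          where B = "\<lambda>v. (B *v v, spaB B *v v)" and B' = ?B' and P = R and J = ?J])
      show "linear (\<lambda>v. (B *v v, spaB B *v v))"
        by (rule linearI) (simp_all add: matrix_vector_right_distrib matrix_vector_mult_scaleR)
      show "(B *v v, spaB B *v v) \<bullet> w = v \<bullet> ?B' w" for v w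
        using inner_matrix_vector[of "fst w" B v] inner_matrix_vector[of "snd w" "spaB B" v]
        by (simp add: inner_prod_def inner_add_right inner_commute)
      show "linear R" unfolding R_def by (intro linear_compose_add linear_compose_scale_right P Y)
      show "v \<bullet> R w = R v \<bullet> w" for v w
        by (simp add: R_def inner_add_left inner_add_right P(2) Y(2))
      show "0 < w \<bullet> R w" if "w \<noteq> 0" for w
        using P_psd[of w] Y_pos[OF that] \<open>0 < e\<close> by (simp add: R_def inner_add_right add_nonneg_pos)
      show "lyap_form ?A' ?N' R w \<le> - (norm (?B' w))\<^sup>2" for w
      proof (cases "w = 0")
        case False
        then have "e * lyap_form ?A' ?N' Y w < 0" using Y_neg \<open>0 < e\<close> by (simp add: mult_pos_neg)
        then show ?thesis unfolding R_def lyap_form_add_scaleR P_form by linarith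
      qed (simp add: lyap_form_def diag_map_def flip: zero_prod_def)
      \<comment> \<open>A vanishing \<open>N k\<close> also makes its reduced counterpart vanish, so
        the index set of \<open>u_zero\<close> serves both systems.\<close>
      show "diag_map (N k) (?N k) v = 0" if "k \<notin> ?J" for k v
      proof -
        have "?N k = 0"
          using that by (simp add: spaN_def blk11_def blk12_def vec_eq_iff matrix_matrix_mult_def)
        then show ?thesis using that by (simp add: diag_map_def zero_prod_def)
      qed
      show "((\<lambda>s. diag_map A ?A (?z s) + (B *v u s, spaB B *v u s)
            + (\<Sum>k\<in>UNIV. u s $ k *\<^sub>R diag_map (N k) (?N k) (?z s))) has_integral ?z r) {0..r}"
        if "0 \<le> r" for r
        using has_integral_Pair[OF x_traj[unfolded bilinear_traj_def, rule_format, OF that]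
            xhat_traj[unfolded bilinear_traj_def, rule_format, OF that]]
        by (simp add: diag_map_def scalar_mult_eq_scaleR sum_prod)
    qed (use u_int_t uJ_int_t in auto)
    then show ?thesis by (simp add: R_def inner_add_right)
  qed
  \<comment> \<open>\<open>P\<close> itself may be singular; the estimates for
    \<open>P + e Y\<close> pass to the limit as \<open>e\<close> tends to 0 from the right.\<close>
  have bound: "(v \<bullet> ?z t)\<^sup>2 \<le> (v \<bullet> P v) * E" for v
  proof (rule tendsto_lowerbound)
    show "((\<lambda>e. (v \<bullet> P v + e * (v \<bullet> Y v)) * E) \<longlongrightarrow> (v \<bullet> P v) * E) (at_right 0)"
      by (auto intro!: tendsto_eq_intros)
    show "\<forall>\<^sub>F e in at_right 0. (v \<bullet> ?z t)\<^sup>2 \<le> (v \<bullet> P v + e * (v \<bullet> Y v)) * E"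
      using bound_eps by (simp add: eventually_at_filter)
  qed simp

  \<comment> \<open>Output error and trace\<close>
  have trace_eq: "(\<Sum>i\<in>UNIV. c i \<bullet> P (c i)) = ?tr"
  proof -
    have mixed: "row i ?C \<bullet> (transpose Pg *v row i C) = row i C \<bullet> (Pg *v row i ?C)" for i
      using inner_matrix_vector[of "row i C" Pg "row i ?C"] by (simp add: inner_commute)
    have "c i \<bullet> P (c i) = row i C \<bullet> (?S *v row i C) - 2 * (row i C \<bullet> (Pg *v row i ?C))
        + row i ?C \<bullet> (Phat *v row i ?C)" for i
      by (simp add: c_def P_def block_map_def inner_add_right inner_diff_right matrix_vector_uminus_right mixed
          del: transpose_matrix_vector)
    then have "(\<Sum>i\<in>UNIV. c i \<bullet> P (c i)) = (transpose C ** C) \<bullet> ?S - 2 * ((transpose C ** ?C) \<bullet> Pg)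
        + (transpose ?C ** ?C) \<bullet> Phat"
      by (simp add: sum.distrib sum_subtractf sum_distrib_left[symmetric] sum_rows_inner)
    also have "\<dots> = ?tr" by (rule spa_error_trace[OF gramP gramQ A22_inv H_eq Pg_eq])
    finally show ?thesis .
  qed
  \<comment> \<open>The trace is a sum of values of a semidefinite form, so its square root is a
    genuine one.\<close>
  have tr0: "0 \<le> ?tr" using trace_eq P_psd by (metis (no_types, lifting) sum_nonneg)
  have "(norm (C *v x t - ?C *v xhat t))\<^sup>2 = (\<Sum>i\<in>UNIV. (c i \<bullet> ?z t)\<^sup>2)"
  proof -
    have "(C *v x t - ?C *v xhat t) $ i = c i \<bullet> ?z t" for i
      by (simp add: c_def matrix_vector_mul_component row_def vec_lambda_eta)
    then show ?thesis unfolding power2_norm_eq_inner inner_vec_def by (simp add: power2_eq_square)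
  qed
  also have "\<dots> \<le> (\<Sum>i\<in>UNIV. (c i \<bullet> P (c i)) * E)" by (intro sum_mono bound)
  also have "\<dots> = ?tr * E" by (simp add: sum_distrib_right[symmetric] trace_eq)
  \<comment> \<open>Both integrands are nonnegative, so extending the integrals to the half-line
    makes the bound independent of \<open>t\<close>.\<close>
  also have "\<dots> \<le> ?tr * (exp ((L2norm (u_zero N u))\<^sup>2) * (L2norm u)\<^sup>2)"
  proof (rule mult_left_mono[OF _ tr0])
    have "integral {0..t} (\<lambda>s. (norm (u s))\<^sup>2) \<le> integral {0..} (\<lambda>s. (norm (u s))\<^sup>2)"
      by (rule integral_subset_le[OF _ u_int_t u_int]) auto
    moreover have "0 \<le> integral {0..t} (\<lambda>s. (norm (u s))\<^sup>2)" by (rule integral_nonneg[OF u_int_t]) simp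
    moreover have "integral {0..t} (\<lambda>s. \<Sum>k\<in>?J. (u s $ k)\<^sup>2) \<le> integral {0..} (\<lambda>s. \<Sum>k\<in>?J. (u s $ k)\<^sup>2)"
      by (rule integral_subset_le[OF _ uJ_int_t uJ_int]) (auto intro: sum_nonneg)
    moreover have "0 \<le> integral {0..t} (\<lambda>s. \<Sum>k\<in>?J. (u s $ k)\<^sup>2)"
      by (rule integral_nonneg[OF uJ_int_t]) (simp add: sum_nonneg)
    ultimately show "E \<le> exp ((L2norm (u_zero N u))\<^sup>2) * (L2norm u)\<^sup>2"
      unfolding E_def L2norm_def norm_u_zero by (intro mult_mono) auto
  qed
  also have "\<dots> = (sqrt ?tr * exp (0.5 * (L2norm (u_zero N u))\<^sup>2) * L2norm u)\<^sup>2"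
    using tr0 by (simp add: power_mult_distrib exp_double[symmetric])
  finally show "norm (C *v x t - ?C *v xhat t) \<le> sqrt ?tr * exp (0.5 * (L2norm (u_zero N u))\<^sup>2) * L2norm u"
  proof (rule power2_le_imp_le)
    have "0 \<le> L2norm u" unfolding L2norm_def using integral_nonneg[OF u_int] by simp
    then show "0 \<le> sqrt ?tr * exp (0.5 * (L2norm (u_zero N u))\<^sup>2) * L2norm u" using tr0 by simp
  qed
qed

end
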